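(* For every $c\geq2$ there is $N(c)\in\mathbb{N}$ such that for any $n_1,n_2\in\mathbb{N}$ with $\max\{n_1,n_2\}>N(c)$, every concise tensor $T\in\mathbb{F}^{n_1}\otimes\mathbb{F}^{n_2}\otimes\mathbb{F}^c$ satisfies $\lim_{m\to\infty} Q(T^{\boxtimes m})^{1/m}=c$.
   Context: $\mathbb{F}$ is any field. $T$ is concise if each of its three flattenings (grouping two tensor legs) has full rank $n_1$, $n_2$, $c$ respectively. The subrank $Q(T)$ is the largest $r$ such that there are linear maps $L_i$ with $(L_1\otimes L_2\otimes L_3)T=\sum_{i=1}^r e_i\otimes e_i\otimes e_i$; $\boxtimes$ is the Kronecker product, and $\lim_{m\to\infty} Q(T^{\boxtimes m})^{1/m}$ is the asymptotic subrank. *)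

theory Defs
  imports Complex_Main "Jordan_Normal_Form.DL_Rank"
begin

(* An element of F^n1 \<otimes> F^n2 \<otimes> F^n3 is given by its coordinates in the standard basis.
   The dimensions are passed separately; entries outside {..<n1} x {..<n2} x {..<n3} are
   irrelevant. *)
type_synonym 'a tensor3 = "nat \<Rightarrow> nat \<Rightarrow> nat \<Rightarrow> 'a"

(* The two grouped legs are indexed by a pair (u, v), encoded as u * d + v with v < d. *)
definition flattening1 :: "nat \<Rightarrow> nat \<Rightarrow> nat \<Rightarrow> 'a tensor3 \<Rightarrow> 'a mat" where
  "flattening1 n1 n2 n3 T = mat n1 (n2 * n3) (\<lambda>(i, q). T i (q div n3) (q mod n3))"

definition flattening2 :: "nat \<Rightarrow> nat \<Rightarrow> nat \<Rightarrow> 'a tensor3 \<Rightarrow> 'a mat" where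
  "flattening2 n1 n2 n3 T = mat n2 (n1 * n3) (\<lambda>(j, q). T (q div n3) j (q mod n3))"

definition flattening3 :: "nat \<Rightarrow> nat \<Rightarrow> nat \<Rightarrow> 'a tensor3 \<Rightarrow> 'a mat" where
  "flattening3 n1 n2 n3 T = mat n3 (n1 * n2) (\<lambda>(k, q). T (q div n2) (q mod n2) k)"

definition concise :: "nat \<Rightarrow> nat \<Rightarrow> nat \<Rightarrow> 'a::field tensor3 \<Rightarrow> bool" where
  "concise n1 n2 n3 T \<longleftrightarrow>
     vec_space.rank n1 (flattening1 n1 n2 n3 T) = n1 \<and>
     vec_space.rank n2 (flattening2 n1 n2 n3 T) = n2 \<and>
     vec_space.rank n3 (flattening3 n1 n2 n3 T) = n3"

(* (L1 \<otimes> L2 \<otimes> L3) T, where the linear map L_s : F^(n_s) \<rightarrow> F^(r_s) is given by its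
   r_s x n_s matrix. *)
definition apply_maps ::
  "nat \<Rightarrow> nat \<Rightarrow> nat \<Rightarrow> 'a::field mat \<Rightarrow> 'a mat \<Rightarrow> 'a mat \<Rightarrow> 'a tensor3 \<Rightarrow> 'a tensor3" where
  "apply_maps n1 n2 n3 L1 L2 L3 T = (\<lambda>a b c.
     \<Sum>i<n1. \<Sum>j<n2. \<Sum>k<n3. L1 $$ (a, i) * L2 $$ (b, j) * L3 $$ (c, k) * T i j k)"

(* The coordinates of the sum of e_i \<otimes> e_i \<otimes> e_i over i < r, on indices below r. *)
definition unit_tensor :: "'a::field tensor3" where
  "unit_tensor = (\<lambda>a b c. if a = b \<and> b = c then 1 else 0)"

definition restricts_to_unit :: "nat \<Rightarrow> nat \<Rightarrow> nat \<Rightarrow> 'a::field tensor3 \<Rightarrow> nat \<Rightarrow> bool" where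
  "restricts_to_unit n1 n2 n3 T r \<longleftrightarrow>
     (\<exists>L1 \<in> carrier_mat r n1. \<exists>L2 \<in> carrier_mat r n2. \<exists>L3 \<in> carrier_mat r n3.
        \<forall>a<r. \<forall>b<r. \<forall>c<r. apply_maps n1 n2 n3 L1 L2 L3 T a b c = unit_tensor a b c)"

(* The set contains 0, and comparing flattening ranks bounds it by min n1 (min n2 n3), so the
   maximum exists. *)
definition subrank :: "nat \<Rightarrow> nat \<Rightarrow> nat \<Rightarrow> 'a::field tensor3 \<Rightarrow> nat" where
  "subrank n1 n2 n3 T = Max {r. restricts_to_unit n1 n2 n3 T r}"

(* The dimensions d1, d2, d3 are those of the second factor T; the product basis vector
   e_u \<otimes> e_v of the s-th leg has index u * d_s + v. *)
definition kronecker ::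
  "nat \<Rightarrow> nat \<Rightarrow> nat \<Rightarrow> 'a::field tensor3 \<Rightarrow> 'a tensor3 \<Rightarrow> 'a tensor3" where
  "kronecker d1 d2 d3 S T = (\<lambda>i j k.
     S (i div d1) (j div d2) (k div d3) * T (i mod d1) (j mod d2) (k mod d3))"

(* For T of dimensions (n1, n2, n3) the m-th power has dimensions (n1^m, n2^m, n3^m). *)
primrec kronecker_power ::
  "nat \<Rightarrow> nat \<Rightarrow> nat \<Rightarrow> 'a::field tensor3 \<Rightarrow> nat \<Rightarrow> 'a tensor3" where
  "kronecker_power n1 n2 n3 T 0 = (\<lambda>_ _ _. 1)"
| "kronecker_power n1 n2 n3 T (Suc m) = kronecker n1 n2 n3 (kronecker_power n1 n2 n3 T m) T"

end

(* View T as a space of n1 x n2 slices. If n1 or n2 is large, the slices of small rank do not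
   span, so some slice A, together with all of its translates by a complementary hyperplane H of
   slices, has large rank. Then T can be restricted to a block triangular tensor: on an old block of
   size at most c - 1 the hyperplane H is still linearly independent, while on a new block of size M,
   with M as large as we like, H vanishes and A is the identity matrix.

   In the m-th power, keep only words with exactly a positions in the old block on each of the first
   two legs, and with exactly a letters in H on the third leg. By triangularity the three sets of
   positions must agree. On them an independent family of matrices remains, tensored with an identity
   matrix of size M^(m-a); this contains a unit tensor with one summand per word as soon as M^(m-a)
   is large enough to index the choices on the old block. For the most frequent type a this
   gives subrank at least c^m / (m+1). *)
theory Submission
  imports Defs "HOL-Library.Function_Algebras"
begin

text \<open>The delicate point is the new block. The hyperplane H may itself contain slices of low
  rank, so independence of the images under all slices is out of reach. It is enough that each image
  of a new vector under A lies outside the span of all the other images, which is exactly what a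
  dual vector on the second leg needs. Low-rank combinations inside H are absorbed into a finite set
  of vectors to avoid. That set also contains the images of the old vectors under every slice, which
  makes one of the two mixed blocks vanish. Slices of bounded rank cannot span, because then all
  images would lie in a space of bounded dimension, against conciseness on the second leg.
  \<open>M\<close> can be fixed in terms of \<open>c\<close> alone: the most frequent type leaves
  about \<open>m / c\<close> or more positions on the new block, so a fixed power of
  \<open>c\<close> per new position pays for fewer than \<open>c * c\<close> choices per old
  position.\<close>

section \<open>Spaces of operators of large rank\<close>

text \<open>The recursion pays for dropping operators one at a time. Here \<open>e\<close> counts
  the operators besides a distinguished one, \<open>y\<close> is the size of the set to avoid and
  \<open>M\<close> the number of vectors wanted. With \<open>e + 1\<close> others, \<open>r\<close>
  is the rank that lets all \<open>e + 2\<close> operators be treated jointly; otherwise one of them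
  is traded for at most \<open>r\<close> further vectors to avoid.\<close>

primrec rank_bound :: "nat \<Rightarrow> nat \<Rightarrow> nat \<Rightarrow> nat" where
  "rank_bound M 0 y = y + M + 1"
| "rank_bound M (Suc e) y =
     (let r = y + M * (e + 2) + (e + 2)\<^sup>2 in max r (rank_bound M e (y + r)))"

lemma rank_bound_mono: "y \<le> y' \<Longrightarrow> rank_bound M e y \<le> rank_bound M e y'"
proof (induction e arbitrary: y y')
  case (Suc e)
  define r where "r y = y + M * (e + 2) + (e + 2)\<^sup>2" for y
  have "r y \<le> r y'" using Suc.prems by (simp add: r_def)
  moreover from this have "rank_bound M e (y + r y) \<le> rank_bound M e (y' + r y')"
    using Suc.prems by (intro Suc.IH) simp
  moreover have "rank_bound M (Suc e) z = max (r z) (rank_bound M e (z + r z))" for z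
    by (simp add: r_def Let_def)
  ultimately show ?case by (metis max.mono)
qed simp

text \<open>A locale of its own: definitions made inside \<^locale>\<open>vector_space\<close> are shadowed by their
  instances for \<^class>\<open>real_vector\<close>.\<close>

locale linear_space = vector_space scale
  for scale :: "'a::field \<Rightarrow> 'b::ab_group_add \<Rightarrow> 'b"
begin

text \<open>Rank is measured by a spanning set of the range, so that a range can be merged by a
  union with a set of vectors to avoid.\<close>

definition low_rank :: "nat \<Rightarrow> ('x \<Rightarrow> 'b) \<Rightarrow> bool" where
  "low_rank r B \<longleftrightarrow> (\<exists>S. finite S \<and> card S \<le> r \<and> range B \<subseteq> span S)"

text \<open>Independence in the quotient by \<open>Y\<close>. It is stated for families, so that a
  repeated vector counts as a dependence.\<close>

definition indep_modulo :: "'b set \<Rightarrow> 'i set \<Rightarrow> ('i \<Rightarrow> 'b) \<Rightarrow> bool" where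
  "indep_modulo Y I g \<longleftrightarrow>
     (\<forall>\<alpha>. (\<Sum>i\<in>I. scale (\<alpha> i) (g i)) \<in> Y \<longrightarrow> (\<forall>i\<in>I. \<alpha> i = 0))"

lemma low_rank_mono: "low_rank r B \<Longrightarrow> r \<le> r' \<Longrightarrow> low_rank r' B"
  unfolding low_rank_def by (meson le_trans)

lemma not_low_rankD:
  fixes B :: "'x \<Rightarrow> 'b"
  assumes "\<not> low_rank r B" "finite S" "card S \<le> r"
  obtains z where "B z \<notin> span S"
  using assms unfolding low_rank_def by auto

lemma indep_moduloD:
  "indep_modulo Y I g \<Longrightarrow> (\<Sum>i\<in>I. scale (\<alpha> i) (g i)) \<in> Y \<Longrightarrow> i \<in> I \<Longrightarrow> \<alpha> i = 0"
  unfolding indep_modulo_def by blast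

lemma indep_modulo_insert:
  assumes "finite I" "j \<notin> I" "subspace Y" "indep_modulo Y I g"
    and notin: "\<And>\<mu>. g j - (\<Sum>i\<in>I. scale (\<mu> i) (g i)) \<notin> Y"
  shows "indep_modulo Y (insert j I) g"
  unfolding indep_modulo_def
proof (intro allI impI)
  fix \<alpha> assume *: "(\<Sum>i\<in>insert j I. scale (\<alpha> i) (g i)) \<in> Y"
  have sum: "(\<Sum>i\<in>insert j I. scale (\<alpha> i) (g i)) = scale (\<alpha> j) (g j) + (\<Sum>i\<in>I. scale (\<alpha> i) (g i))"
    using assms by simp
  have "\<alpha> j = 0"
  proof (rule ccontr)
    assume nz: "\<alpha> j \<noteq> 0"
    have "scale (inverse (\<alpha> j)) (scale (\<alpha> j) (g j) + (\<Sum>i\<in>I. scale (\<alpha> i) (g i))) \<in> Y"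
      using * assms(3) sum subspace_scale by metis
    also have "scale (inverse (\<alpha> j)) (scale (\<alpha> j) (g j) + (\<Sum>i\<in>I. scale (\<alpha> i) (g i)))
        = g j - (\<Sum>i\<in>I. scale (- (inverse (\<alpha> j) * \<alpha> i)) (g i))"
      using nz by (simp add: scale_right_distrib scale_sum_right sum_negf)
    finally show False using notin[of "\<lambda>i. - (inverse (\<alpha> j) * \<alpha> i)"] by contradiction
  qed
  with * sum have "(\<Sum>i\<in>I. scale (\<alpha> i) (g i)) \<in> Y" by simp
  with \<open>\<alpha> j = 0\<close> assms(4) show "\<forall>i\<in>insert j I. \<alpha> i = 0"
    using indep_moduloD[OF assms(4)] by blast
qed

lemma span_Un_image:
  assumes "finite I" "v \<in> span (S \<union> g ` I)"
  obtains \<mu> where "v - (\<Sum>i\<in>I. scale (\<mu> i) (g i)) \<in> span S"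
proof -
  have "\<exists>\<mu>. v - (\<Sum>i\<in>I. scale (\<mu> i) (g i)) \<in> span S"
    using assms
  proof (induction I arbitrary: v rule: finite_induct)
    case empty
    then show ?case by simp
  next
    case (insert j I)
    have "v \<in> span (insert (g j) (S \<union> g ` I))" using insert.prems by simp
    then obtain k where "v - scale k (g j) \<in> span (S \<union> g ` I)"
      by (auto simp: span_insert)
    from insert.IH[OF this] obtain \<mu> where
      \<mu>: "v - scale k (g j) - (\<Sum>i\<in>I. scale (\<mu> i) (g i)) \<in> span S" by (elim exE)
    have "(\<Sum>i\<in>I. scale ((\<mu>(j := k)) i) (g i)) = (\<Sum>i\<in>I. scale (\<mu> i) (g i))"
      using insert.hyps by (intro sum.cong) auto
    then have "v - (\<Sum>i\<in>insert j I. scale ((\<mu>(j := k)) i) (g i)) \<in> span S"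
      using \<mu> insert.hyps by (simp add: algebra_simps)
    then show ?case by (rule exI[where x = "\<mu>(j := k)"])
  qed
  then show thesis using that by (elim exE)
qed

lemma span_Un_image_iff:
  assumes "finite I"
  shows "v \<in> span (S \<union> g ` I) \<longleftrightarrow> (\<exists>\<mu>. v - (\<Sum>i\<in>I. scale (\<mu> i) (g i)) \<in> span S)"
proof
  assume "\<exists>\<mu>. v - (\<Sum>i\<in>I. scale (\<mu> i) (g i)) \<in> span S"
  then obtain \<mu> where *: "v - (\<Sum>i\<in>I. scale (\<mu> i) (g i)) \<in> span S" by (elim exE)
  have "(\<Sum>i\<in>I. scale (\<mu> i) (g i)) \<in> span (S \<union> g ` I)"
    by (intro span_sum span_scale span_base) auto
  from span_add[OF span_mono[THEN subsetD, OF _ *] this]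
  show "v \<in> span (S \<union> g ` I)" by simp
next
  assume "v \<in> span (S \<union> g ` I)"
  then obtain \<mu> where "v - (\<Sum>i\<in>I. scale (\<mu> i) (g i)) \<in> span S"
    by (rule span_Un_image[OF assms])
  then show "\<exists>\<mu>. v - (\<Sum>i\<in>I. scale (\<mu> i) (g i)) \<in> span S"
    by (rule exI[where x = \<mu>])
qed

lemma indep_modulo_Un:
  assumes "finite J" "indep_modulo (span (S \<union> g ` J)) I h"
  shows "(\<Sum>i\<in>I. scale (\<alpha> i) (h i)) + (\<Sum>j\<in>J. scale (\<mu> j) (g j)) \<in> span S \<Longrightarrow> i \<in> I \<Longrightarrow> \<alpha> i = 0"
proof -
  assume *: "(\<Sum>i\<in>I. scale (\<alpha> i) (h i)) + (\<Sum>j\<in>J. scale (\<mu> j) (g j)) \<in> span S" and i: "i \<in> I"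
  have "(\<Sum>i\<in>I. scale (\<alpha> i) (h i)) - (\<Sum>j\<in>J. scale (- \<mu> j) (g j)) \<in> span S"
    using * by (simp add: sum_negf)
  then have "(\<Sum>i\<in>I. scale (\<alpha> i) (h i)) \<in> span (S \<union> g ` J)"
    unfolding span_Un_image_iff[OF assms(1)] by (rule exI[where x = "\<lambda>j. - \<mu> j"])
  from indep_moduloD[OF assms(2) this i] show "\<alpha> i = 0" .
qed

lemma indep_modulo_mono: "indep_modulo Y I g \<Longrightarrow> Y' \<subseteq> Y \<Longrightarrow> indep_modulo Y' I g"
  unfolding indep_modulo_def by blast

text \<open>The argument needs no generic choice of scalars, so it works over every field: if
  \<open>x\<^sub>1\<close> and \<open>v\<close> are independent for the operators in \<open>K\<close>, and the image of
  \<open>x\<^sub>1\<close>, of \<open>v\<close> and of \<open>x\<^sub>1 + v\<close> under the operator \<open>w\<close> is each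
  dependent on theirs, then additivity makes the three coefficient families equal.\<close>

lemma exists_indep_modulo:
  fixes A :: "'k \<Rightarrow> 'x::ab_group_add \<Rightarrow> 'b"
  assumes "finite K"
    and add: "\<And>k x y. A k (x + y) = A k x + A k y"
    and "finite S"
    and "\<And>\<alpha>. \<exists>k\<in>K. \<alpha> k \<noteq> 0 \<Longrightarrow> \<not> low_rank (card S + (card K)\<^sup>2) (\<lambda>x. \<Sum>k\<in>K. scale (\<alpha> k) (A k x))"
  shows "\<exists>x. indep_modulo (span S) K (\<lambda>k. A k x)"
  using assms(1,3,4)
proof (induction K arbitrary: S rule: finite_induct)
  case empty
  then show ?case by (simp add: indep_modulo_def)
next
  case (insert w K)
  note fin = \<open>finite K\<close> and wK = \<open>w \<notin> K\<close>
  have high: "\<not> low_rank (card S + (card K + 1)\<^sup>2) (\<lambda>x. scale (\<alpha> w) (A w x) + (\<Sum>k\<in>K. scale (\<alpha> k) (A k x)))"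
    if "\<exists>k\<in>insert w K. \<alpha> k \<noteq> 0" for \<alpha>
    using insert.prems(2)[OF that] fin wK by simp
  have highK: "\<not> low_rank r (\<lambda>x. \<Sum>k\<in>K. scale (\<alpha> k) (A k x))"
    if "\<exists>k\<in>K. \<alpha> k \<noteq> 0" "r \<le> card S + (card K + 1)\<^sup>2" for \<alpha> r
  proof -
    have "(\<Sum>k\<in>K. scale ((\<alpha>(w := 0)) k) (A k x)) = (\<Sum>k\<in>K. scale (\<alpha> k) (A k x))" for x
      using wK by (intro sum.cong) auto
    moreover have "\<exists>k\<in>insert w K. (\<alpha>(w := 0)) k \<noteq> 0" using that(1) wK by fastforce
    ultimately have "\<not> low_rank (card S + (card K + 1)\<^sup>2) (\<lambda>x. \<Sum>k\<in>K. scale (\<alpha> k) (A k x))"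
      using high[of "\<alpha>(w := 0)"] by simp
    then show ?thesis using low_rank_mono[OF _ that(2)] by blast
  qed
  \<comment> \<open>One more operator enlarges the square by \<open>2 * card K + 1\<close>, which is
    room for the images of the two vectors \<open>x1\<close> and \<open>z\<close> added to
    \<open>S\<close> below. This is the origin of the square in the rank hypothesis.\<close>
  have le: "card S + 2 * card K + (card K)\<^sup>2 \<le> card S + (card K + 1)\<^sup>2"
    by (simp add: power2_eq_square)
  show ?case
  proof (rule ccontr)
    assume neg: "\<not> ?case"
    have dep: "\<exists>\<mu>. A w x - (\<Sum>k\<in>K. scale (\<mu> k) (A k x)) \<in> span S"
      if "indep_modulo (span S) K (\<lambda>k. A k x)" for x
    proof (rule ccontr)
      assume "\<not> ?thesis"
      then have "A w x - (\<Sum>k\<in>K. scale (\<mu> k) (A k x)) \<notin> span S" for \<mu> by simp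
      from indep_modulo_insert[OF fin wK subspace_span that this] neg show False by blast
    qed
    obtain x1 where x1: "indep_modulo (span S) K (\<lambda>k. A k x1)"
    proof -
      have "card S + (card K)\<^sup>2 \<le> card S + (card K + 1)\<^sup>2" using le by linarith
      from insert.IH[OF insert.prems(1) highK[OF _ this]] that show thesis by blast
    qed
    from dep[OF x1] obtain \<alpha> where
      \<alpha>: "A w x1 - (\<Sum>k\<in>K. scale (\<alpha> k) (A k x1)) \<in> span S" by (elim exE)
    define B where "B x = A w x - (\<Sum>k\<in>K. scale (\<alpha> k) (A k x))" for x
    have Badd: "B (x + y) = B x + B y" for x y
      by (simp add: B_def add scale_right_distrib sum.distrib)
    have "B = (\<lambda>x. scale (((\<lambda>k. - \<alpha> k)(w := 1)) w) (A w x) + (\<Sum>k\<in>K. scale (((\<lambda>k. - \<alpha> k)(w := 1)) k) (A k x)))"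
    proof
      fix x
      have "(\<Sum>k\<in>K. scale (((\<lambda>k. - \<alpha> k)(w := 1)) k) (A k x)) = (\<Sum>k\<in>K. scale (- \<alpha> k) (A k x))"
        using wK by (intro sum.cong) auto
      then show "B x = scale (((\<lambda>k. - \<alpha> k)(w := 1)) w) (A w x) + (\<Sum>k\<in>K. scale (((\<lambda>k. - \<alpha> k)(w := 1)) k) (A k x))"
        by (simp add: B_def sum_negf)
    qed
    moreover have "\<exists>k\<in>insert w K. ((\<lambda>k. - \<alpha> k)(w := 1)) k \<noteq> 0" by simp
    ultimately have "\<not> low_rank (card S + (card K + 1)\<^sup>2) B"
      using high[of "(\<lambda>k. - \<alpha> k)(w := 1)"] by simp
    \<comment> \<open>\<open>z\<close> need not be independent for \<open>K\<close>, so it is only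
      used as a correction: an \<open>x\<close> independent modulo the images of both
      \<open>x1\<close> and \<open>z\<close> makes \<open>x\<close> and \<open>x + z\<close> equally
      good, and \<open>B\<close> cannot send both into \<open>span S\<close>.\<close>
    from not_low_rankD[OF this insert.prems(1)] obtain z where z: "B z \<notin> span S" by auto
    define S1 where "S1 = S \<union> (\<lambda>k. A k x1) ` K"
    define S2 where "S2 = S1 \<union> (\<lambda>k. A k z) ` K"
    have "card S2 \<le> card S1 + card K"
      unfolding S2_def using card_Un_le card_image_le[OF fin]
      by (meson add_left_mono le_trans)
    moreover have "card S1 \<le> card S + card K"
      unfolding S1_def using card_Un_le card_image_le[OF fin]
      by (meson add_left_mono le_trans)
    ultimately have card: "card S2 + (card K)\<^sup>2 \<le> card S + (card K + 1)\<^sup>2" using le by linarith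
    have "finite S2" using insert.prems(1) fin by (simp add: S2_def S1_def)
    from insert.IH[OF this highK[OF _ card]] obtain x where x: "indep_modulo (span S2) K (\<lambda>k. A k x)"
      by blast
    have good_x: "indep_modulo (span S1) K (\<lambda>k. A k x)"
      using x by (rule indep_modulo_mono) (auto simp: S2_def intro: span_mono[THEN subsetD])
    have good_xz: "indep_modulo (span S1) K (\<lambda>k. A k (x + z))"
      unfolding indep_modulo_def
    proof (intro allI impI ballI)
      fix \<mu> i assume "(\<Sum>k\<in>K. scale (\<mu> k) (A k (x + z))) \<in> span S1" "i \<in> K"
      then show "\<mu> i = 0"
        using indep_modulo_Un[OF fin x[unfolded S2_def], of \<mu> \<mu> i]
        by (simp add: add scale_right_distrib sum.distrib)
    qed
    obtain v where v: "indep_modulo (span S1) K (\<lambda>k. A k v)" and Bv: "B v \<notin> span S"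
    proof (cases "B x \<in> span S")
      case True
      with z have "B (x + z) \<notin> span S" by (simp add: Badd span_add_eq)
      with that good_xz show thesis by blast
    qed (use that good_x in blast)
    have "indep_modulo (span S) K (\<lambda>k. A k v)"
      using v by (rule indep_modulo_mono) (auto simp: S1_def intro: span_mono[THEN subsetD])
    from dep[OF this] obtain \<mu> where
      \<mu>: "A w v - (\<Sum>k\<in>K. scale (\<mu> k) (A k v)) \<in> span S" by (elim exE)
    have key: "\<nu> i = 0 \<and> \<rho> i = 0"
      if comb: "(\<Sum>k\<in>K. scale (\<nu> k) (A k x1)) + (\<Sum>k\<in>K. scale (\<rho> k) (A k v)) \<in> span S" and i: "i \<in> K" for \<nu> \<rho> i
    proof -
      have \<rho>: "\<rho> j = 0" if "j \<in> K" for j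
        using indep_modulo_Un[OF fin v[unfolded S1_def], of \<rho> \<nu> j] comb that
        by (simp add: add.commute)
      then have "(\<Sum>k\<in>K. scale (\<rho> k) (A k v)) = 0" by simp
      with comb have "(\<Sum>k\<in>K. scale (\<nu> k) (A k x1)) \<in> span S" by simp
      from indep_moduloD[OF x1 this i] \<rho>[OF i] show ?thesis by simp
    qed
    have "indep_modulo (span S) K (\<lambda>k. A k (x1 + v))"
      unfolding indep_modulo_def
    proof (intro allI impI ballI)
      fix \<nu> i assume "(\<Sum>k\<in>K. scale (\<nu> k) (A k (x1 + v))) \<in> span S" "i \<in> K"
      then show "\<nu> i = 0"
        using key[of \<nu> \<nu> i] by (simp add: add scale_right_distrib sum.distrib)
    qed
    from dep[OF this] obtain \<nu> where
      \<nu>: "A w (x1 + v) - (\<Sum>k\<in>K. scale (\<nu> k) (A k (x1 + v))) \<in> span S" by (elim exE)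
    have "(\<Sum>k\<in>K. scale (\<nu> k - \<alpha> k) (A k x1)) + (\<Sum>k\<in>K. scale (\<nu> k - \<mu> k) (A k v))
      = (A w x1 - (\<Sum>k\<in>K. scale (\<alpha> k) (A k x1))) + (A w v - (\<Sum>k\<in>K. scale (\<mu> k) (A k v)))
        - (A w (x1 + v) - (\<Sum>k\<in>K. scale (\<nu> k) (A k (x1 + v))))"
      by (simp add: add scale_right_distrib scale_left_diff_distrib sum.distrib sum_subtractf)
    also have "\<dots> \<in> span S" by (rule span_diff[OF span_add[OF \<alpha> \<mu>] \<nu>])
    finally have "\<nu> k - \<alpha> k = 0 \<and> \<nu> k - \<mu> k = 0" if "k \<in> K" for k
      using key[of "\<lambda>k. \<nu> k - \<alpha> k" "\<lambda>k. \<nu> k - \<mu> k" k] that by blast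
    then have "\<alpha> k = \<mu> k" if "k \<in> K" for k using that by fastforce
    then have "B v = A w v - (\<Sum>k\<in>K. scale (\<mu> k) (A k v))" by (simp add: B_def)
    with \<mu> Bv show False by simp
  qed
qed

text \<open>Vectors are added one at a time. The images of those already found, at most
  \<open>card K\<close> for each, join the set to avoid; this is the term
  \<open>M * card K\<close>.\<close>

lemma exists_joint_indep_modulo:
  fixes A :: "'k \<Rightarrow> 'x::ab_group_add \<Rightarrow> 'b"
  assumes "finite K"
    and "\<And>k x y. A k (x + y) = A k x + A k y"
    and "finite S"
    and "\<And>\<alpha>. \<exists>k\<in>K. \<alpha> k \<noteq> 0 \<Longrightarrow>
      \<not> low_rank (card S + M * card K + (card K)\<^sup>2) (\<lambda>x. \<Sum>k\<in>K. scale (\<alpha> k) (A k x))"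
  shows "\<exists>x. indep_modulo (span S) (K \<times> {..<M}) (\<lambda>(k, j). A k (x j))"
  using assms(4)
proof (induction M)
  case 0
  then show ?case by (simp add: indep_modulo_def)
next
  case (Suc M)
  have "\<exists>x. indep_modulo (span S) (K \<times> {..<M}) (\<lambda>(k, j). A k (x j))"
  proof (rule Suc.IH)
    fix \<alpha> :: "'k \<Rightarrow> 'a" assume "\<exists>k\<in>K. \<alpha> k \<noteq> 0"
    from Suc.prems[OF this]
    show "\<not> low_rank (card S + M * card K + (card K)\<^sup>2) (\<lambda>x. \<Sum>k\<in>K. scale (\<alpha> k) (A k x))"
      using low_rank_mono by fastforce
  qed
  then obtain x where x: "indep_modulo (span S) (K \<times> {..<M}) (\<lambda>(k, j). A k (x j))" by blast
  define S' where "S' = S \<union> (\<lambda>(k, j). A k (x j)) ` (K \<times> {..<M})"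
  have "card ((\<lambda>(k, j). A k (x j)) ` (K \<times> {..<M})) \<le> M * card K"
    using card_image_le[of "K \<times> {..<M}" "\<lambda>(k, j). A k (x j)"] assms(1)
    by (simp add: card_cartesian_product mult.commute)
  then have "card S' \<le> card S + M * card K"
    unfolding S'_def by (meson card_Un_le add_left_mono le_trans)
  then have card: "card S' + (card K)\<^sup>2 \<le> card S + Suc M * card K + (card K)\<^sup>2" by simp
  have "finite S'" using assms(1,3) by (simp add: S'_def)
  then have "\<exists>z. indep_modulo (span S') K (\<lambda>k. A k z)"
  proof (rule exists_indep_modulo[where A = A, OF assms(1,2)])
    fix \<alpha> :: "'k \<Rightarrow> 'a" assume "\<exists>k\<in>K. \<alpha> k \<noteq> 0"
    from Suc.prems[OF this]
    show "\<not> low_rank (card S' + (card K)\<^sup>2) (\<lambda>x. \<Sum>k\<in>K. scale (\<alpha> k) (A k x))"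
      using low_rank_mono card by blast
  qed
  then obtain z where z: "indep_modulo (span S') K (\<lambda>k. A k z)" by blast
  define x' where "x' = x(M := z)"
  have "indep_modulo (span S) (K \<times> {..<Suc M}) (\<lambda>(k, j). A k (x' j))"
    unfolding indep_modulo_def
  proof (intro allI impI)
    fix \<alpha> :: "'k \<times> nat \<Rightarrow> 'a"
    assume *: "(\<Sum>i\<in>K \<times> {..<Suc M}. scale (\<alpha> i) (case i of (k, j) \<Rightarrow> A k (x' j))) \<in> span S"
    have "(\<Sum>i\<in>K \<times> {..<Suc M}. scale (\<alpha> i) (case i of (k, j) \<Rightarrow> A k (x' j)))
      = (\<Sum>k\<in>K. \<Sum>j<Suc M. scale (\<alpha> (k, j)) (A k (x' j)))"
      by (subst sum.cartesian_product) (simp add: split_def)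
    also have "\<dots> = (\<Sum>k\<in>K. scale (\<alpha> (k, M)) (A k z)) + (\<Sum>k\<in>K. \<Sum>j<M. scale (\<alpha> (k, j)) (A k (x j)))"
      by (simp add: x'_def sum.distrib add.commute)
    also have "(\<Sum>k\<in>K. \<Sum>j<M. scale (\<alpha> (k, j)) (A k (x j)))
      = (\<Sum>i\<in>K \<times> {..<M}. scale (\<alpha> i) ((\<lambda>(k, j). A k (x j)) i))"
      by (simp add: sum.cartesian_product split_def)
    finally have eq: "(\<Sum>i\<in>K \<times> {..<Suc M}. scale (\<alpha> i) (case i of (k, j) \<Rightarrow> A k (x' j)))
      = (\<Sum>k\<in>K. scale (\<alpha> (k, M)) (A k z)) + (\<Sum>i\<in>K \<times> {..<M}. scale (\<alpha> i) ((\<lambda>(k, j). A k (x j)) i))" .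
    have new: "\<alpha> (k, M) = 0" if "k \<in> K" for k
      using indep_modulo_Un[OF _ z[unfolded S'_def], of "\<lambda>k. \<alpha> (k, M)" \<alpha> k] * eq that assms(1) by simp
    then have "(\<Sum>k\<in>K. scale (\<alpha> (k, M)) (A k z)) = 0" by simp
    with * eq have "(\<Sum>i\<in>K \<times> {..<M}. scale (\<alpha> i) ((\<lambda>(k, j). A k (x j)) i)) \<in> span S" by simp
    from indep_moduloD[OF x this, of "(k, j)" for k j] new show "\<forall>i\<in>K \<times> {..<Suc M}. \<alpha> i = 0"
      by (auto simp: less_Suc_eq)
  qed
  then show ?case by blast
qed

lemma low_rank_scaleD:
  assumes "low_rank r (\<lambda>x. scale c (B x))" "c \<noteq> 0"
  shows "low_rank r B"
proof -
  obtain S where S: "finite S" "card S \<le> r" "range (\<lambda>x. scale c (B x)) \<subseteq> span S"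
    using assms(1) unfolding low_rank_def by blast
  have "B x \<in> span S" for x
  proof -
    have "scale c (B x) \<in> span S" using S(3) by blast
    then have "scale (inverse c) (scale c (B x)) \<in> span S" by (rule span_scale)
    then show ?thesis using assms(2) by simp
  qed
  with S(1,2) show ?thesis unfolding low_rank_def by blast
qed

text \<open>The favourable case, in which no nontrivial combination has small rank: then all images
  are jointly independent, which is more than the conclusion asks.\<close>

lemma joint_notin_span_if_high_rank:
  fixes A :: "'k \<Rightarrow> 'x::ab_group_add \<Rightarrow> 'b"
  assumes "\<And>k x y. A k (x + y) = A k x + A k y" "finite K" "k0 \<in> K" "finite S"
    and "\<And>\<alpha>. \<exists>k\<in>K. \<alpha> k \<noteq> 0 \<Longrightarrow>
      \<not> low_rank (card S + M * card K + (card K)\<^sup>2) (\<lambda>x. \<Sum>k\<in>K. scale (\<alpha> k) (A k x))"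
  shows "\<exists>x. \<forall>j<M. A k0 (x j) \<notin> span (S \<union> (\<lambda>(k, i). A k (x i)) ` (K \<times> {..<M} - {(k0, j)}))"
proof -
  obtain x where x: "indep_modulo (span S) (K \<times> {..<M}) (\<lambda>(k, j). A k (x j))"
    using exists_joint_indep_modulo[where A = A, OF assms(2,1,4,5)] by blast
  define g where "g = (\<lambda>(k, j). A k (x j))"
  have "g (k0, j) \<notin> span (S \<union> g ` (K \<times> {..<M} - {(k0, j)}))" if j: "j < M" for j
  proof
    define I where "I = K \<times> {..<M} - {(k0, j)}"
    have I: "finite I" "(k0, j) \<notin> I" "K \<times> {..<M} = insert (k0, j) I"
      using assms(2,3) j by (auto simp: I_def)
    assume "g (k0, j) \<in> span (S \<union> g ` (K \<times> {..<M} - {(k0, j)}))"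
    then obtain \<mu> where \<mu>: "g (k0, j) - (\<Sum>i\<in>I. scale (\<mu> i) (g i)) \<in> span S"
      unfolding I_def[symmetric] using span_Un_image[OF I(1)] by metis
    define \<nu> where "\<nu> = (\<lambda>i. if i = (k0, j) then 1 else - \<mu> i)"
    have "(\<Sum>i\<in>I. scale (\<nu> i) (g i)) = (\<Sum>i\<in>I. scale (- \<mu> i) (g i))"
      using I(2) by (intro sum.cong) (auto simp: \<nu>_def)
    then have "(\<Sum>i\<in>K \<times> {..<M}. scale (\<nu> i) (g i)) = g (k0, j) - (\<Sum>i\<in>I. scale (\<mu> i) (g i))"
      using I(1,2) by (simp add: I(3) sum_negf \<nu>_def)
    with \<mu> have "(\<Sum>i\<in>K \<times> {..<M}. scale (\<nu> i) (g i)) \<in> span S" by simp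
    from indep_moduloD[OF x[folded g_def] this, of "(k0, j)"] show False
      using assms(3) j by (simp add: \<nu>_def)
  qed
  then show ?thesis unfolding g_def by auto
qed

text \<open>If a combination of the operators in \<open>K\<close> has low rank, then one of them can be dropped
  from \<open>K\<close> at the cost of adding the range of that combination to \<open>S\<close>.\<close>

lemma exists_joint_notin_span:
  fixes A :: "'k \<Rightarrow> 'x::ab_group_add \<Rightarrow> 'b"
  assumes add: "\<And>k x y. A k (x + y) = A k x + A k y"
    and "finite K" "k0 \<notin> K" "finite S"
    and "\<And>\<alpha>. \<not> low_rank (rank_bound M (card K) (card S)) (\<lambda>x. A k0 x + (\<Sum>k\<in>K. scale (\<alpha> k) (A k x)))"
  shows "\<exists>x. \<forall>j<M. A k0 (x j) \<notin>
    span (S \<union> (\<lambda>(k, i). A k (x i)) ` (insert k0 K \<times> {..<M} - {(k0, j)}))"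
  using assms(2-)
proof (induction "card K" arbitrary: K S)
  case 0
  then have [simp]: "K = {}" by simp
  have "\<not> low_rank (card S + M * card {k0} + (card {k0})\<^sup>2) (\<lambda>x. \<Sum>k\<in>{k0}. scale (\<alpha> k) (A k x))"
    if "\<exists>k\<in>{k0}. \<alpha> k \<noteq> 0" for \<alpha>
    using low_rank_scaleD[of "card S + M + 1" "\<alpha> k0" "A k0"] "0.prems"(4) that by auto
  from joint_notin_span_if_high_rank[where A = A, OF add _ _ "0.prems"(3) this, of k0] show ?case
    by simp
next
  case (Suc e)
  note finK = Suc.prems(1) and k0K = Suc.prems(2) and finS = Suc.prems(3) and high = Suc.prems(4)
  define r where "r = card S + M * (e + 2) + (e + 2)\<^sup>2"
  have rb: "rank_bound M (card K) (card S) = max r (rank_bound M e (card S + r))"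
    by (simp add: Suc.hyps(2)[symmetric] r_def Let_def)
  show ?case
  \<comment> \<open>The hypothesis controls every combination with a nonzero coefficient at
    \<open>k0\<close>, after scaling, so the joint argument can fail only through a combination
    inside \<open>K\<close>.\<close>
  proof (cases "\<exists>\<beta>. (\<exists>k\<in>K. \<beta> k \<noteq> 0) \<and> low_rank r (\<lambda>x. \<Sum>k\<in>K. scale (\<beta> k) (A k x))")
    case True
    then obtain \<beta> k1 S1 where k1: "k1 \<in> K" "\<beta> k1 \<noteq> 0" and S1: "finite S1" "card S1 \<le> r"
      and sp: "range (\<lambda>x. \<Sum>k\<in>K. scale (\<beta> k) (A k x)) \<subseteq> span S1"
      unfolding low_rank_def by blast
    define K' where "K' = K - {k1}"
    define S' where "S' = S \<union> S1"
    have "card S' \<le> card S + r" unfolding S'_def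
      using S1(2) card_Un_le[of S S1] by linarith
    moreover have cardK': "card K' = e" using Suc.hyps(2) k1(1) finK by (simp add: K'_def)
    ultimately have le: "rank_bound M (card K') (card S') \<le> rank_bound M (card K) (card S)"
      using rank_bound_mono[of "card S'" "card S + r" M e] by (simp add: rb le_max_iff_disj)
    have highK': "\<not> low_rank (rank_bound M (card K') (card S'))
        (\<lambda>x. A k0 x + (\<Sum>k\<in>K'. scale (\<alpha> k) (A k x)))" for \<alpha>
    proof -
      have "(\<Sum>k\<in>K. scale ((\<alpha>(k1 := 0)) k) (A k x)) = (\<Sum>k\<in>K'. scale (\<alpha> k) (A k x))" for x
        unfolding K'_def using finK k1(1)
        by (subst sum.remove[of K k1]) (auto intro!: sum.cong)
      then show ?thesis
        using high[of "\<alpha>(k1 := 0)"] low_rank_mono[OF _ le] by auto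
    qed
    have "e = card K'" "finite K'" "k0 \<notin> K'" "finite S'"
      using Suc.hyps(2) k1(1) finK k0K finS S1(1) by (auto simp: K'_def S'_def)
    from Suc.hyps(1)[OF this highK'] obtain x where x: "\<forall>j<M. A k0 (x j) \<notin>
      span (S' \<union> (\<lambda>(k, i). A k (x i)) ` (insert k0 K' \<times> {..<M} - {(k0, j)}))" by blast
    \<comment> \<open>The images under \<open>k1\<close> are recovered from \<open>S1\<close> and
      the operators in \<open>K'\<close>. As \<open>k0\<close> is not among these, the pair
      \<open>(k0, j)\<close> can stay excluded.\<close>
    have "span (S \<union> (\<lambda>(k, i). A k (x i)) ` (insert k0 K \<times> {..<M} - {(k0, j)})) \<subseteq>
      span (S' \<union> (\<lambda>(k, i). A k (x i)) ` (insert k0 K' \<times> {..<M} - {(k0, j)}))" (is "_ \<subseteq> span ?G") for j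
    proof (rule span_minimal)
      have gen: "A k (x i) \<in> span ?G" if "k \<in> insert k0 K'" "i < M" "(k, i) \<noteq> (k0, j)" for k i
        using that by (intro span_base) force
      have "A k1 (x i) \<in> span ?G" if i: "i < M" for i
      proof -
        have "(\<Sum>k\<in>K. scale (\<beta> k) (A k (x i))) \<in> span S1" using sp by blast
        moreover have "span S1 \<subseteq> span ?G" by (intro span_mono) (auto simp: S'_def)
        ultimately have "(\<Sum>k\<in>K. scale (\<beta> k) (A k (x i))) \<in> span ?G" by blast
        moreover have "(\<Sum>k\<in>K'. scale (\<beta> k) (A k (x i))) \<in> span ?G"
          using gen i k0K by (intro span_sum span_scale) (auto simp: K'_def)
        ultimately have "(\<Sum>k\<in>K. scale (\<beta> k) (A k (x i))) - (\<Sum>k\<in>K'. scale (\<beta> k) (A k (x i))) \<in> span ?G"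
          by (rule span_diff)
        then have "scale (\<beta> k1) (A k1 (x i)) \<in> span ?G"
          using finK k1(1) by (simp add: K'_def sum.remove)
        then have "scale (inverse (\<beta> k1)) (scale (\<beta> k1) (A k1 (x i))) \<in> span ?G" by (rule span_scale)
        then show ?thesis using k1(2) by simp
      qed
      moreover have "S \<subseteq> span ?G" by (auto simp: S'_def intro: span_base)
      ultimately show "S \<union> (\<lambda>(k, i). A k (x i)) ` (insert k0 K \<times> {..<M} - {(k0, j)}) \<subseteq> span ?G"
        using gen by (auto simp: K'_def)
    qed simp
    with x show ?thesis by (intro exI[where x = x]) blast
  next
    case False
    have card: "card (insert k0 K) = e + 2" using finK k0K Suc.hyps(2) by simp
    have "\<not> low_rank (card S + M * card (insert k0 K) + (card (insert k0 K))\<^sup>2)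
        (\<lambda>x. \<Sum>k\<in>insert k0 K. scale (\<alpha> k) (A k x))" if nz: "\<exists>k\<in>insert k0 K. \<alpha> k \<noteq> 0" for \<alpha>
    proof (cases "\<alpha> k0 = 0")
      case True
      with nz False have "\<not> low_rank r (\<lambda>x. \<Sum>k\<in>K. scale (\<alpha> k) (A k x))" by auto
      then show ?thesis using True finK k0K unfolding card r_def by simp
    next
      case nz: False
      have eq: "(\<lambda>x. \<Sum>k\<in>insert k0 K. scale (\<alpha> k) (A k x)) =
        (\<lambda>x. scale (\<alpha> k0) (A k0 x + (\<Sum>k\<in>K. scale (\<alpha> k / \<alpha> k0) (A k x))))"
        using nz finK k0K by (simp add: scale_right_distrib scale_sum_right)
      have "\<not> low_rank r (\<lambda>x. A k0 x + (\<Sum>k\<in>K. scale (\<alpha> k / \<alpha> k0) (A k x)))"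
        using high[of "\<lambda>k. \<alpha> k / \<alpha> k0"] low_rank_mono[of r _ "max r (rank_bound M e (card S + r))"]
        unfolding rb by auto
      then have "\<not> low_rank r (\<lambda>x. scale (\<alpha> k0) (A k0 x + (\<Sum>k\<in>K. scale (\<alpha> k / \<alpha> k0) (A k x))))"
        using low_rank_scaleD[of r "\<alpha> k0" "\<lambda>x. A k0 x + (\<Sum>k\<in>K. scale (\<alpha> k / \<alpha> k0) (A k x))"] nz by argo
      then show ?thesis unfolding card r_def[symmetric] eq .
    qed
    from joint_notin_span_if_high_rank[where A = A, OF add _ _ finS this, of k0] finK show ?thesis by simp
  qed
qed

text \<open>A basis of \<open>span S\<close> together with \<open>v\<close> extends to a basis of
  the whole space; the functional is the coordinate at \<open>v\<close>.\<close>

lemma separating_functional: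
  assumes "v \<notin> span S"
  obtains f where "\<And>x y. f (x + y) = f x + f y" "\<And>c x. f (scale c x) = c * f x"
    "\<And>s. s \<in> S \<Longrightarrow> f s = 0" "f v = 1"
proof -
  obtain B where B: "B \<subseteq> S" "independent B" "S \<subseteq> span B"
    using maximal_independent_subset by blast
  have "span S = span B" using B by (metis span_mono span_span subset_antisym)
  then have "v \<notin> span B" using assms by simp
  then have vB: "v \<notin> B" "independent (insert v B)"
    using B by (auto simp: span_base independent_insert)
  define E where "E = extend_basis (insert v B)"
  have E: "independent E" "span E = UNIV" "insert v B \<subseteq> E"
    unfolding E_def
    by (rule independent_extend_basis[OF vB(2)] span_extend_basis[OF vB(2)] extend_basis_superset[OF vB(2)])+
  define f where "f x = representation E x v" for x
  have add: "f (x + y) = f x + f y" for x y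
    using representation_add[OF E(1), of y x] E(2) by (simp add: f_def)
  have scale: "f (scale c x) = c * f x" for c x
    using representation_scale[OF E(1), of x c] E(2) by (simp add: f_def)
  have fB: "f b = 0" if "b \<in> B" for b
    using representation_basis[OF E(1), of b] E(3) that vB(1) by (auto simp: f_def)
  have "f s = 0" if "s \<in> S" for s
  proof -
    have "s \<in> span B" using B(3) that by blast
    then show ?thesis
      by (induction rule: span_induct_alt) (use add scale fB scale[of 0 0] in auto)
  qed
  moreover have "f v = 1" using representation_basis[OF E(1), of v] E(3) by (simp add: f_def)
  ultimately show thesis using that add scale by blast
qed

end

section \<open>Coordinate vectors as functions: separation and annihilators\<close>

abbreviation (input) fun_scale :: "'a::field \<Rightarrow> ('i \<Rightarrow> 'a) \<Rightarrow> 'i \<Rightarrow> 'a" where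
  "fun_scale \<equiv> (\<lambda>c f i. c * f i)"

interpretation fun_space: linear_space fun_scale
  by unfold_locales (auto simp: fun_eq_iff algebra_simps)

definition unit_fun :: "'i \<Rightarrow> 'i \<Rightarrow> 'a::field" where
  "unit_fun j = (\<lambda>i. if i = j then 1 else 0)"

lemma sum_fun_apply: "(\<Sum>x\<in>X. f x) i = (\<Sum>x\<in>X. f x i :: 'a::comm_monoid_add)"
  by (induction X rule: infinite_finite_induct) auto

lemma fun_eq_sum_unit_fun:
  assumes "finite J" "\<And>i. i \<notin> J \<Longrightarrow> v i = 0"
  shows "v = (\<Sum>j\<in>J. fun_scale (v j) (unit_fun j))"
proof
  fix i
  show "v i = (\<Sum>j\<in>J. fun_scale (v j) (unit_fun j)) i"
    using assms by (cases "i \<in> J") (auto simp: sum_fun_apply unit_fun_def if_distrib cong: if_cong)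
qed

text \<open>On functions supported in \<open>J\<close> a linear functional is a dot product, with
  its values at the unit functions as coefficients.\<close>

lemma separating_vector:
  fixes v :: "'i \<Rightarrow> 'a::field"
  assumes "finite J" "v \<notin> fun_space.span S"
    and S: "\<And>s i. s \<in> S \<Longrightarrow> i \<notin> J \<Longrightarrow> s i = 0" and v: "\<And>i. i \<notin> J \<Longrightarrow> v i = 0"
  obtains y where "\<And>s. s \<in> S \<Longrightarrow> (\<Sum>j\<in>J. y j * s j) = 0" "(\<Sum>j\<in>J. y j * v j) = 1"
proof -
  obtain f :: "('i \<Rightarrow> 'a) \<Rightarrow> 'a" where f: "\<And>x y. f (x + y) = f x + f y" "\<And>c x. f (fun_scale c x) = c * f x"
    "\<And>s. s \<in> S \<Longrightarrow> f s = 0" "f v = 1"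
    using fun_space.separating_functional[OF assms(2)] by blast
  have f0: "f 0 = 0" using f(1)[of 0 0] by (metis add_0 add_left_imp_eq add.right_neutral)
  have fsum: "f (\<Sum>j\<in>X. h j) = (\<Sum>j\<in>X. f (h j))" for X :: "'i set" and h
    by (induction X rule: infinite_finite_induct)
       (simp_all only: sum.infinite sum.empty sum.insert f(1) f0 simp_thms)
  have "f u = (\<Sum>j\<in>J. f (unit_fun j) * u j)" if "\<And>i. i \<notin> J \<Longrightarrow> u i = 0" for u
    by (subst fun_eq_sum_unit_fun[OF assms(1) that], assumption)
       (simp add: fsum f(2) mult.commute)
  then show thesis using that[of "\<lambda>j. f (unit_fun j)"] f(3,4) S v by metis
qed

text \<open>If some unit function lies outside the span of \<open>L\<close>, separating it yields
  \<open>\<phi>\<close>; otherwise a maximal independent subset of \<open>L\<close> spans and has at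
  most \<open>card K\<close> elements. The dichotomy serves three times: for dimension counts, for
  the slices of low rank, and for the choice of the old block.\<close>

lemma annihilator_or_spanning:
  fixes L :: "('k \<Rightarrow> 'a::field) set"
  assumes K: "finite K" and L: "\<And>v k. v \<in> L \<Longrightarrow> k \<notin> K \<Longrightarrow> v k = 0"
  shows "(\<exists>\<phi>. (\<exists>k\<in>K. \<phi> k \<noteq> 0) \<and> (\<forall>v\<in>L. (\<Sum>k\<in>K. \<phi> k * v k) = 0)) \<or>
    (\<exists>F\<subseteq>L. finite F \<and> card F \<le> card K \<and> (\<forall>k\<in>K. unit_fun k \<in> fun_space.span F))"
proof (cases "\<forall>k\<in>K. unit_fun k \<in> fun_space.span L")
  case True
  obtain B where B: "B \<subseteq> L" "fun_space.independent B" "L \<subseteq> fun_space.span B"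
    using fun_space.maximal_independent_subset by blast
  have "v \<in> fun_space.span (unit_fun ` K)" if "v \<in> B" for v
  proof -
    have "(\<Sum>k\<in>K. fun_scale (v k) (unit_fun k)) \<in> fun_space.span (unit_fun ` K)"
      by (intro fun_space.span_sum fun_space.span_scale[of "unit_fun _"] fun_space.span_base imageI)
    moreover have "v = (\<Sum>k\<in>K. fun_scale (v k) (unit_fun k))"
      using L B(1) that by (intro fun_eq_sum_unit_fun[OF K]) blast
    ultimately show ?thesis by metis
  qed
  then have "finite B \<and> card B \<le> card (unit_fun ` K :: ('k \<Rightarrow> 'a) set)"
    using K B(2) by (intro fun_space.independent_span_bound) auto
  moreover have "card (unit_fun ` K :: ('k \<Rightarrow> 'a) set) \<le> card K" using K by (rule card_image_le)
  moreover have "fun_space.span L \<subseteq> fun_space.span B"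
    using B(3) by (metis fun_space.span_mono fun_space.span_span)
  ultimately have "finite B \<and> card B \<le> card K \<and> (\<forall>k\<in>K. unit_fun k \<in> fun_space.span B)"
    using True by auto
  with B(1) show ?thesis by blast
next
  case False
  then obtain k where k: "k \<in> K" "unit_fun k \<notin> fun_space.span L" by blast
  obtain y where
    y: "\<And>s. s \<in> L \<Longrightarrow> (\<Sum>j\<in>K. y j * s j) = 0" "(\<Sum>j\<in>K. y j * unit_fun k j) = (1::'a)"
    by (rule separating_vector[OF K k(2)]) (use k(1) L in \<open>auto simp: unit_fun_def\<close>)
  from y(2) have "\<exists>j\<in>K. y j \<noteq> 0" by (metis (no_types, lifting) mult_zero_left sum.neutral zero_neq_one)
  with y(1) show ?thesis by blast
qed

lemma inj_unit_fun: "inj (unit_fun :: 'i \<Rightarrow> 'i \<Rightarrow> 'a::field)"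
  by (auto simp: inj_def unit_fun_def fun_eq_iff split: if_splits)

lemma independent_unit_fun:
  assumes "finite J"
  shows "fun_space.independent (unit_fun ` J :: ('i \<Rightarrow> 'a::field) set)"
proof (rule fun_space.independent_if_scalars_zero)
  fix f :: "('i \<Rightarrow> 'a) \<Rightarrow> 'a" and x :: "'i \<Rightarrow> 'a"
  assume *: "(\<Sum>x\<in>unit_fun ` J. fun_scale (f x) x) = 0" and "x \<in> unit_fun ` J"
  then obtain j where j: "j \<in> J" "x = unit_fun j" by blast
  have "inj_on (unit_fun :: 'i \<Rightarrow> 'i \<Rightarrow> 'a) J"
    by (rule inj_on_subset[OF inj_unit_fun]) simp
  then have "(\<Sum>i\<in>J. fun_scale (f (unit_fun i)) (unit_fun i)) j = 0"
    using * by (simp add: sum.reindex)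
  then show "f x = 0" using j assms by (simp add: sum_fun_apply unit_fun_def if_distrib cong: if_cong)
qed (use assms in simp)

lemma exists_annihilator_supported:
  fixes S :: "('i \<Rightarrow> 'a::field) set"
  assumes "finite J" "finite S" "card S < card J" "\<And>v i. v \<in> S \<Longrightarrow> i \<notin> J \<Longrightarrow> v i = 0"
  obtains y where "\<exists>j\<in>J. y j \<noteq> 0" "\<And>v. v \<in> S \<Longrightarrow> (\<Sum>j\<in>J. y j * v j) = 0"
proof -
  have "\<not> (\<exists>F\<subseteq>S. \<forall>k\<in>J. unit_fun k \<in> fun_space.span F)"
  proof safe
    fix F assume F: "F \<subseteq> S" "\<forall>k\<in>J. unit_fun k \<in> fun_space.span F"
    have fF: "finite F" using F assms finite_subset by blast
    have "card (unit_fun ` J :: ('i \<Rightarrow> 'a) set) \<le> card F"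
      using fun_space.independent_span_bound[OF fF independent_unit_fun[OF assms(1)]] F(2) by blast
    moreover have "card (unit_fun ` J :: ('i \<Rightarrow> 'a) set) = card J"
      by (meson card_image inj_on_subset inj_unit_fun subset_UNIV)
    moreover have "card F \<le> card S" using F assms by (meson card_mono)
    ultimately show False using assms(3) by simp
  qed
  moreover have "(\<exists>\<phi>. (\<exists>k\<in>J. \<phi> k \<noteq> 0) \<and> (\<forall>v\<in>S. (\<Sum>k\<in>J. \<phi> k * v k) = 0)) \<or>
    (\<exists>F\<subseteq>S. finite F \<and> card F \<le> card J \<and> (\<forall>k\<in>J. unit_fun k \<in> fun_space.span F))"
    using assms(1,4) by (rule annihilator_or_spanning)
  ultimately show thesis using that by blast
qed

section \<open>Block structure of a concise tensor\<close>

text \<open>Entries outside \<open>J\<close> do not affect the dot products, so \<open>S\<close> may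
  be truncated before counting dimensions; linearity then passes from \<open>S\<close> to its
  span.\<close>

lemma exists_annihilator:
  fixes S :: "('i \<Rightarrow> 'a::field) set"
  assumes "finite J" "finite S" "card S < card J"
  obtains y where "\<exists>j\<in>J. y j \<noteq> 0" "\<And>v. v \<in> fun_space.span S \<Longrightarrow> (\<Sum>j\<in>J. y j * v j) = 0"
proof -
  define trunc :: "('i \<Rightarrow> 'a) \<Rightarrow> 'i \<Rightarrow> 'a" where "trunc v = (\<lambda>i. if i \<in> J then v i else 0)" for v
  have "card (trunc ` S) < card J" using card_image_le[OF assms(2), of trunc] assms(3) by linarith
  then obtain y where y: "\<exists>j\<in>J. y j \<noteq> 0" "\<And>v. v \<in> trunc ` S \<Longrightarrow> (\<Sum>j\<in>J. y j * v j) = 0"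
    using assms(1,2) by (rule_tac exists_annihilator_supported[of J "trunc ` S"]) (auto simp: trunc_def)
  have gen: "(\<Sum>j\<in>J. y j * v j) = 0" if "v \<in> S" for v
    using y(2)[OF imageI[OF that]] by (simp add: trunc_def)
  have "(\<Sum>j\<in>J. y j * v j) = 0" if "v \<in> fun_space.span S" for v
    using that
  proof (induction rule: fun_space.span_induct_alt)
    case (step c x z)
    have "(\<Sum>j\<in>J. y j * (fun_scale c x + z) j) = c * (\<Sum>j\<in>J. y j * x j) + (\<Sum>j\<in>J. y j * z j)"
      by (simp add: algebra_simps sum.distrib sum_distrib_left)
    then show ?case using gen[OF step(1)] step(2) by simp
  qed simp
  with y(1) that show thesis by blast
qed

text \<open>Full row rank puts a basis among the columns, so each unit vector is a combination of
  columns; pairing it with \<open>y\<close> gives both \<open>y i\<close> and 0. This turns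
  conciseness into the absence of linear relations between slices.\<close>

lemma full_rank_left_kernel:
  fixes A :: "'a::field mat"
  assumes A: "A \<in> carrier_mat n nc" and rank: "vec_space.rank n A = n"
    and y: "\<And>q. q < nc \<Longrightarrow> (\<Sum>i<n. y i * A $$ (i, q)) = 0"
    and i: "i < n"
  shows "y i = 0"
proof -
  interpret vec_space "TYPE('a)" n .
  have cols: "set (cols A) \<subseteq> carrier_vec n" using A cols_dim by blast
  obtain U where U: "finite U" "maximal U (\<lambda>T. T \<subseteq> set (cols A) \<and> lin_indpt T)"
    using maximal_exists_superset[of "set (cols A)" "\<lambda>T. T \<subseteq> set (cols A) \<and> lin_indpt T" "{}"]
    by (auto simp: lin_dep_def)
  then have "card U = n" using rank_card_indpt[OF A] rank by simp
  have sub: "U \<subseteq> set (cols A)" "lin_indpt U" using U(2) by (auto simp: maximal_def)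
  have "basis U"
    using sub cols \<open>card U = n\<close> U(1) by (intro dim_li_is_basis) (auto simp: dim_is_n)
  then have "span U = carrier_vec n" by (simp add: basis_def)
  then have "unit_vec n i \<in> span U" by simp
  then obtain a B where B: "unit_vec n i = lincomb a B" "finite B" "B \<subseteq> U"
    using in_spanE by blast
  have zero: "(\<Sum>l<n. y l * x $ l) = 0" if "x \<in> B" for x
  proof -
    have "x \<in> set (cols A)" using that B(3) sub(1) by blast
    then obtain q where "q < nc" "x = col A q" using A by (auto simp: in_set_conv_nth)
    then show ?thesis using y[of q] A by simp
  qed
  have "y i = (\<Sum>l<n. y l * unit_vec n i $ l)" using i by (simp add: unit_vec_def if_distrib cong: if_cong)
  also have "\<dots> = (\<Sum>l<n. y l * (\<Sum>x\<in>B. a x * x $ l))"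
    unfolding B(1) using B sub cols by (intro sum.cong) (auto simp: lincomb_index)
  also have "\<dots> = (\<Sum>x\<in>B. a x * (\<Sum>l<n. y l * x $ l))"
    by (simp add: sum_distrib_left sum.swap[of _ B] algebra_simps)
  also have "\<dots> = 0" using zero by simp
  finally show ?thesis .
qed

lemma concise_leg2:
  assumes "concise n1 n2 n3 T" "\<And>i k. i < n1 \<Longrightarrow> k < n3 \<Longrightarrow> (\<Sum>j<n2. y j * T i j k) = 0" "j < n2"
  shows "y j = 0"
proof (rule full_rank_left_kernel)
  show "flattening2 n1 n2 n3 T \<in> carrier_mat n2 (n1 * n3)" by (simp add: flattening2_def)
  show "vec_space.rank n2 (flattening2 n1 n2 n3 T) = n2" using assms(1) by (simp add: concise_def)
  show "(\<Sum>j<n2. y j * flattening2 n1 n2 n3 T $$ (j, q)) = 0" if q: "q < n1 * n3" for q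
  proof -
    have "n3 > 0" using q by (cases n3) auto
    then have "q div n3 < n1" "q mod n3 < n3" using q by (auto simp: less_mult_imp_div_less)
    with assms(2)[of "q div n3" "q mod n3"] q show ?thesis by (simp add: flattening2_def)
  qed
qed fact

lemma concise_leg3:
  assumes "concise n1 n2 n3 T" "\<And>i j. i < n1 \<Longrightarrow> j < n2 \<Longrightarrow> (\<Sum>k<n3. w k * T i j k) = 0" "k < n3"
  shows "w k = 0"
proof (rule full_rank_left_kernel)
  show "flattening3 n1 n2 n3 T \<in> carrier_mat n3 (n1 * n2)" by (simp add: flattening3_def)
  show "vec_space.rank n3 (flattening3 n1 n2 n3 T) = n3" using assms(1) by (simp add: concise_def)
  show "(\<Sum>k<n3. w k * flattening3 n1 n2 n3 T $$ (k, q)) = 0" if q: "q < n1 * n2" for q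
  proof -
    have "n2 > 0" using q by (cases n2) auto
    then have "q div n2 < n1" "q mod n2 < n2" using q by (auto simp: less_mult_imp_div_less)
    with assms(2)[of "q div n2" "q mod n2"] q show ?thesis by (simp add: flattening3_def)
  qed
qed fact

text \<open>A rank is at most the number of columns. Thus a large \<open>n1\<close> forces a large
  \<open>n2\<close>, and only the second leg has to be treated as the large one.\<close>

lemma concise_dim1_le:
  assumes "concise n1 n2 n3 T"
  shows "n1 \<le> n2 * n3"
  using assms vec_space.rank_le_nc[of "flattening1 n1 n2 n3 T" n1 "n2 * n3"]
  by (simp add: concise_def flattening1_def)

section \<open>Slices as operators from the first leg to the second\<close>

definition tri_form ::
  "nat \<Rightarrow> nat \<Rightarrow> nat \<Rightarrow> 'a::field tensor3 \<Rightarrow> (nat \<Rightarrow> 'a) \<Rightarrow> (nat \<Rightarrow> 'a) \<Rightarrow> (nat \<Rightarrow> 'a) \<Rightarrow> 'a" where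
  "tri_form n1 n2 n3 T u v w = (\<Sum>i<n1. \<Sum>j<n2. \<Sum>k<n3. u i * v j * w k * T i j k)"

text \<open>The slice in direction \<open>w\<close>, applied to \<open>u\<close>. The value 0 from
  \<open>n2\<close> on keeps all images supported in \<open>{..<n2}\<close>, as
  \<open>separating_vector\<close> demands.\<close>

definition contract ::
  "nat \<Rightarrow> nat \<Rightarrow> nat \<Rightarrow> 'a::field tensor3 \<Rightarrow> (nat \<Rightarrow> 'a) \<Rightarrow> (nat \<Rightarrow> 'a) \<Rightarrow> nat \<Rightarrow> 'a" where
  "contract n1 n2 n3 T w u = (\<lambda>j. if j < n2 then \<Sum>i<n1. \<Sum>k<n3. u i * w k * T i j k else 0)"

lemma tri_form_eq: "tri_form n1 n2 n3 T u v w = (\<Sum>j<n2. v j * contract n1 n2 n3 T w u j)"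
  unfolding tri_form_def
  by (subst sum.swap) (simp add: contract_def sum_distrib_left mult_ac)

lemma contract_add: "contract n1 n2 n3 T w (u + u') = contract n1 n2 n3 T w u + contract n1 n2 n3 T w u'"
  by (auto simp: contract_def fun_eq_iff sum.distrib algebra_simps)

lemma contract_unit:
  "i < n1 \<Longrightarrow> j < n2 \<Longrightarrow> contract n1 n2 n3 T w (unit_fun i) j = (\<Sum>k<n3. w k * T i j k)"
proof -
  assume "i < n1" "j < n2"
  have "(\<Sum>k<n3. unit_fun i l * w k * T l j k) = (if l = i then \<Sum>k<n3. w k * T i j k else 0)" for l
    by (simp add: unit_fun_def)
  with \<open>i < n1\<close> \<open>j < n2\<close> show ?thesis by (simp add: contract_def)
qed

lemma contract_lin:
  "contract n1 n2 n3 T (w + w') u = contract n1 n2 n3 T w u + contract n1 n2 n3 T w' u"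
  "contract n1 n2 n3 T (fun_scale a w) u = fun_scale a (contract n1 n2 n3 T w u)"
  "contract n1 n2 n3 T 0 u = 0"
  by (auto simp: contract_def fun_eq_iff sum.distrib sum_distrib_left algebra_simps)

lemma contract_sum:
  "contract n1 n2 n3 T (\<Sum>k\<in>K. fun_scale (\<alpha> k) (w k)) u = (\<Sum>k\<in>K. fun_scale (\<alpha> k) (contract n1 n2 n3 T (w k) u))"
  by (induction K rule: infinite_finite_induct) (simp_all only: sum.infinite sum.empty sum.insert contract_lin simp_thms)

text \<open>All images under all slices lie in the span of at most \<open>card F * R\<close>
  vectors. If that number were below \<open>n2\<close>, some nonzero \<open>y\<close> would
  annihilate them all, which is a relation on the second leg.\<close>

lemma dim2_le_if_low_rank:
  assumes "concise n1 n2 n3 T" "finite F"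
    and low: "\<And>v. v \<in> F \<Longrightarrow> fun_space.low_rank R (contract n1 n2 n3 T v)"
    and unit: "\<And>k. k < n3 \<Longrightarrow> unit_fun k \<in> fun_space.span F"
  shows "n2 \<le> card F * R"
proof (rule ccontr)
  assume "\<not> n2 \<le> card F * R"
  have "\<exists>S. \<forall>v\<in>F. finite (S v) \<and> card (S v) \<le> R \<and> range (contract n1 n2 n3 T v) \<subseteq> fun_space.span (S v)"
    using low unfolding fun_space.low_rank_def by metis
  then obtain S where S: "\<And>v. v \<in> F \<Longrightarrow> finite (S v) \<and> card (S v) \<le> R"
    "\<And>v u. v \<in> F \<Longrightarrow> contract n1 n2 n3 T v u \<in> fun_space.span (S v)" by blast
  define S' where "S' = \<Union>(S ` F)"
  have "card S' \<le> (\<Sum>v\<in>F. card (S v))" unfolding S'_def by (rule card_UN_le[OF assms(2)])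
  also have "\<dots> \<le> card F * R" using S(1) sum_bounded_above[of F "\<lambda>v. card (S v)" R] by simp
  finally have "card S' < card {..<n2}" using \<open>\<not> n2 \<le> card F * R\<close> by simp
  moreover have "finite S'" using S(1) assms(2) by (auto simp: S'_def)
  ultimately obtain y where y: "\<exists>j\<in>{..<n2}. y j \<noteq> 0"
      "\<And>v. v \<in> fun_space.span S' \<Longrightarrow> (\<Sum>j<n2. y j * v j) = 0"
    using exists_annihilator[of "{..<n2}" S'] by auto
  have contr: "contract n1 n2 n3 T v u \<in> fun_space.span S'" if "v \<in> fun_space.span F" for v u
    using that
  proof (induction rule: fun_space.span_induct_alt)
    case base
    then show ?case by (simp only: contract_lin fun_space.span_zero)
  next
    case (step a v w)
    have "contract n1 n2 n3 T v u \<in> fun_space.span S'"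
      using S(2)[OF step(1)] fun_space.span_mono[of "S v" S'] step(1) by (auto simp: S'_def)
    with step(2) show ?case
      by (simp only: contract_lin fun_space.span_add fun_space.span_scale)
  qed
  have "(\<Sum>j<n2. y j * T i j k) = 0" if "i < n1" "k < n3" for i k
  proof -
    have "(\<Sum>j<n2. y j * contract n1 n2 n3 T (unit_fun k) (unit_fun i) j) = 0"
      using y(2) contr[OF unit[OF that(2)]] by blast
    moreover have "contract n1 n2 n3 T (unit_fun k) (unit_fun i) j = T i j k" if "j < n2" for j
      unfolding contract_unit[OF \<open>i < n1\<close> that] using \<open>k < n3\<close>
      by (simp add: unit_fun_def if_distrib[of "\<lambda>x. x * _"] cong: if_cong)
    ultimately show ?thesis by simp
  qed
  from concise_leg2[OF assms(1) this] y(1) show False by auto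
qed


text \<open>In the new basis \<open>w\<close> of the third leg, the restriction of \<open>T\<close> to the old vectors
  (unit vectors, \<open>E\<close>) and the new vectors (\<open>x\<close>, \<open>y\<close>) is block triangular. The slices other
  than \<open>k0\<close> are independent on the old block, as witnessed by the dual family \<open>C\<close>, and on the new
  block the slice \<open>k0\<close> is an identity matrix while all others vanish.\<close>

definition block_structure ::
  "nat \<Rightarrow> nat \<Rightarrow> nat \<Rightarrow> 'a::field tensor3 \<Rightarrow> nat \<Rightarrow> nat \<Rightarrow> (nat \<Rightarrow> nat \<Rightarrow> 'a) \<Rightarrow> (nat \<times> nat) set \<Rightarrow>
    (nat \<Rightarrow> nat \<times> nat \<Rightarrow> 'a) \<Rightarrow> (nat \<Rightarrow> nat \<Rightarrow> 'a) \<Rightarrow> (nat \<Rightarrow> nat \<Rightarrow> 'a) \<Rightarrow> bool" where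
  "block_structure n1 n2 c T M k0 w E C x y \<longleftrightarrow>
     k0 < c \<and> finite E \<and> card E \<le> c - 1 \<and>
     (\<forall>k\<in>{..<c} - {k0}. \<forall>k'\<in>{..<c} - {k0}.
        (\<Sum>(p, q)\<in>E. C k (p, q) * tri_form n1 n2 c T (unit_fun p) (unit_fun q) (w k')) =
          (if k = k' then 1 else 0)) \<and>
     (\<forall>(p, q)\<in>E. \<forall>j<M. \<forall>k<c. tri_form n1 n2 c T (unit_fun p) (y j) (w k) = 0) \<and>
     (\<forall>i<M. \<forall>j<M. \<forall>k<c.
        tri_form n1 n2 c T (x i) (y j) (w k) = (if k = k0 \<and> i = j then 1 else 0))"

lemma concise_block_structure:
  fixes T :: "'a::field tensor3"
  assumes T: "concise n1 n2 c T" and large: "c * rank_bound M (c - 1) (c * c) < n2"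
  obtains k0 w E C x y where "block_structure n1 n2 c T M k0 w E C x y"
proof -
  define R where "R = rank_bound M (c - 1) (c * c)"
  define Low where "Low = {v. (\<forall>k. k \<notin> {..<c} \<longrightarrow> v k = 0) \<and> fun_space.low_rank R (contract n1 n2 c T v)}"
  have "\<not> (\<exists>F\<subseteq>Low. finite F \<and> card F \<le> card {..<c} \<and> (\<forall>k\<in>{..<c}. unit_fun k \<in> fun_space.span F))"
  proof safe
    fix F assume F: "F \<subseteq> Low" "finite F" "card F \<le> card {..<c}"
      "\<forall>k\<in>{..<c}. unit_fun k \<in> fun_space.span F"
    have "n2 \<le> card F * R"
      using F by (intro dim2_le_if_low_rank[OF T F(2)]) (auto simp: Low_def)
    also have "\<dots> \<le> c * R" using F(3) by simp
    finally show False using large by (simp add: R_def)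
  qed
  moreover have "(\<exists>\<phi>. (\<exists>k\<in>{..<c}. \<phi> k \<noteq> 0) \<and> (\<forall>v\<in>Low. (\<Sum>k<c. \<phi> k * v k) = 0)) \<or>
    (\<exists>F\<subseteq>Low. finite F \<and> card F \<le> card {..<c} \<and> (\<forall>k\<in>{..<c}. unit_fun k \<in> fun_space.span F))"
    by (rule annihilator_or_spanning) (auto simp: Low_def)
  ultimately obtain \<phi> k0 where k0: "k0 < c" "\<phi> k0 \<noteq> 0"
    and \<phi>: "\<And>v. v \<in> Low \<Longrightarrow> (\<Sum>k<c. \<phi> k * v k) = 0" by auto
  define K where "K = {..<c} - {k0}"
  have K: "finite K" "k0 \<notin> K" "{..<c} = insert k0 K" "card K = c - 1" using k0(1) by (auto simp: K_def)
  \<comment> \<open>For \<open>k \<in> K\<close> these vectors form a basis of the kernel of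
    \<open>\<phi>\<close>, whereas \<open>\<phi>\<close> takes the value
    \<open>\<phi> k0 \<noteq> 0\<close> on \<open>w k0\<close>. Hence every translate of
    \<open>w k0\<close> by that hyperplane stays outside \<open>Low\<close>.\<close>
  define w :: "nat \<Rightarrow> nat \<Rightarrow> 'a" where
    "w k = (if k = k0 then unit_fun k0 else unit_fun k + fun_scale (- (\<phi> k / \<phi> k0)) (unit_fun k0))" for k
  have wK: "w k = (\<lambda>l. if l = k then 1 else if l = k0 then - (\<phi> k / \<phi> k0) else 0)" if "k \<in> K" for k
    using that K(2) by (auto simp: w_def unit_fun_def fun_eq_iff)
  have w0: "w k0 = unit_fun k0" by (simp add: w_def)
  have w_outside: "w k l = 0" if "k < c" "l \<notin> {..<c}" for k l
    using that k0(1) by (auto simp: w_def unit_fun_def)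
  have \<phi>w: "(\<Sum>l<c. \<phi> l * w k l) = 0" if "k \<in> K" for k
  proof -
    have "(\<Sum>l\<in>K. \<phi> l * w k l) = (\<Sum>l\<in>K. if l = k then \<phi> k else 0)"
      using K(2) that by (intro sum.cong) (auto simp: wK)
    also have "\<dots> = \<phi> k" using that K(1) by simp
    finally show ?thesis using K that k0(2) by (auto simp: wK)
  qed
  define A where "A k = contract n1 n2 c T (w k)" for k
  have high: "\<not> fun_space.low_rank R (\<lambda>x. A k0 x + (\<Sum>k\<in>K. fun_scale (\<alpha> k) (A k x)))" for \<alpha>
  proof
    assume low: "fun_space.low_rank R (\<lambda>x. A k0 x + (\<Sum>k\<in>K. fun_scale (\<alpha> k) (A k x)))"
    define v where "v = w k0 + (\<Sum>k\<in>K. fun_scale (\<alpha> k) (w k))"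
    have "contract n1 n2 c T v = (\<lambda>x. A k0 x + (\<Sum>k\<in>K. fun_scale (\<alpha> k) (A k x)))"
      by (rule ext) (simp only: v_def A_def contract_lin(1) contract_sum)
    moreover have "v l = 0" if "l \<notin> {..<c}" for l
      using that w_outside k0(1) by (auto simp: v_def sum_fun_apply K_def intro!: sum.neutral)
    ultimately have "v \<in> Low" using low by (auto simp: Low_def)
    then have "(\<Sum>l<c. \<phi> l * v l) = 0" by (rule \<phi>)
    also have "(\<Sum>l<c. \<phi> l * v l) = (\<Sum>l<c. \<phi> l * w k0 l) + (\<Sum>k\<in>K. \<alpha> k * (\<Sum>l<c. \<phi> l * w k l))"
      by (simp add: v_def sum_fun_apply sum_distrib_left algebra_simps sum.distrib sum.swap[of _ K])
    also have "(\<Sum>k\<in>K. \<alpha> k * (\<Sum>l<c. \<phi> l * w k l)) = 0" using \<phi>w by simp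
    also have "(\<Sum>l<c. \<phi> l * w k0 l) = \<phi> k0"
      using k0(1) by (simp add: w0 unit_fun_def if_distrib cong: if_cong)
    finally show False using k0(2) by simp
  qed
  \<comment> \<open>\<open>g (p, q)\<close> collects the entries at position \<open>(p, q)\<close>
    of the slices in \<open>K\<close>. As these slices are independent, the collected vectors span,
    so at most \<open>c - 1\<close> positions suffice for \<open>E\<close>; expanding unit functions
    in them yields the dual coefficients \<open>C\<close>.\<close>
  define g where "g = (\<lambda>(p, q) k. if k \<in> K then A k (unit_fun p) q else 0)"
  define P where "P = {..<n1} \<times> {..<n2}"
  have "\<not> (\<exists>\<psi>. (\<exists>k\<in>K. \<psi> k \<noteq> 0) \<and> (\<forall>v\<in>g ` P. (\<Sum>k\<in>K. \<psi> k * v k) = 0))"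
  proof (intro notI, elim exE conjE)
    fix \<psi> assume nz: "\<exists>k\<in>K. \<psi> k \<noteq> 0" and *: "\<forall>v\<in>g ` P. (\<Sum>k\<in>K. \<psi> k * v k) = 0"
    define v where "v = (\<Sum>k\<in>K. fun_scale (\<psi> k) (w k))"
    have "(\<Sum>k<c. v k * T i j k) = 0" if "i < n1" "j < n2" for i j
    proof -
      have "(\<Sum>k<c. v k * T i j k) = contract n1 n2 c T v (unit_fun i) j"
        by (rule contract_unit[OF that, symmetric])
      also have "\<dots> = (\<Sum>k\<in>K. \<psi> k * A k (unit_fun i) j)"
        unfolding v_def contract_sum A_def by (simp add: sum_fun_apply)
      also have "\<dots> = (\<Sum>k\<in>K. \<psi> k * g (i, j) k)" by (simp add: g_def)
      also have "\<dots> = 0" using * that by (auto simp: P_def)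
      finally show ?thesis .
    qed
    from concise_leg3[OF T this] have v0: "v k = 0" if "k \<in> K" for k using that by (simp add: K_def)
    have "v l = \<psi> l" if "l \<in> K" for l
    proof -
      have "v l = (\<Sum>k\<in>K. if k = l then \<psi> k else 0)"
        using that K(2) by (auto simp: v_def sum_fun_apply wK intro!: sum.cong)
      then show ?thesis using that K(1) by simp
    qed
    with v0 nz show False by simp
  qed
  moreover have "(\<exists>\<psi>. (\<exists>k\<in>K. \<psi> k \<noteq> 0) \<and> (\<forall>v\<in>g ` P. (\<Sum>k\<in>K. \<psi> k * v k) = 0)) \<or>
    (\<exists>F\<subseteq>g ` P. finite F \<and> card F \<le> card K \<and> (\<forall>k\<in>K. unit_fun k \<in> fun_space.span F))"
    by (rule annihilator_or_spanning) (auto simp: g_def K)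
  ultimately obtain F where F: "F \<subseteq> g ` P" "finite F" "card F \<le> card K"
    "\<forall>k\<in>K. unit_fun k \<in> fun_space.span F" by blast
  obtain E where E: "E \<subseteq> P" "inj_on g E" "F = g ` E"
    using F(1) by (auto simp: subset_image_inj)
  have finE: "finite E" using E F(2) finite_image_iff by blast
  have cardE: "card E \<le> c - 1" using F(3) E K(4) by (simp add: card_image)
  have "\<exists>C. unit_fun k = (\<Sum>e\<in>E. fun_scale (C e) (g e))" if "k \<in> K" for k
  proof -
    have "unit_fun k \<in> range (\<lambda>u. \<Sum>v\<in>F. fun_scale (u v) v)"
      using F(4) that fun_space.span_finite[OF F(2)] by auto
    then obtain u where "unit_fun k = (\<Sum>v\<in>F. fun_scale (u v) v)" by blast
    then have "unit_fun k = (\<Sum>e\<in>E. fun_scale (u (g e)) (g e))"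
      unfolding E(3) using E(2) by (simp add: sum.reindex)
    then show ?thesis by (rule exI[where x = "\<lambda>e. u (g e)"])
  qed
  then obtain C where C: "\<And>k. k \<in> K \<Longrightarrow> unit_fun k = (\<Sum>e\<in>E. fun_scale (C k e) (g e))" by metis
  have form_unit: "tri_form n1 n2 c T u (unit_fun q) (w k) = A k u q" if "q < n2" for u q k
    unfolding tri_form_eq A_def using that by (simp add: unit_fun_def if_distrib[of "\<lambda>x. x * _"] cong: if_cong)
  have first: "(\<Sum>(p, q)\<in>E. C k (p, q) * tri_form n1 n2 c T (unit_fun p) (unit_fun q) (w k')) = (if k = k' then 1 else 0)"
    if "k \<in> K" "k' \<in> K" for k k'
  proof -
    have "(\<Sum>(p, q)\<in>E. C k (p, q) * tri_form n1 n2 c T (unit_fun p) (unit_fun q) (w k')) = (\<Sum>e\<in>E. C k e * g e k')"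
      using E(1) that(2) by (intro sum.cong) (auto simp: g_def P_def form_unit)
    also have "\<dots> = unit_fun k k'" using fun_cong[OF C[OF that(1)], of k'] by (simp add: sum_fun_apply)
    finally show ?thesis by (auto simp: unit_fun_def)
  qed
  \<comment> \<open>The new vectors of the second leg must annihilate the old vectors of the first
    leg under every slice, \<open>k0\<close> included. There are at most \<open>c * c\<close> such
    images, hence the last argument of \<open>rank_bound\<close> in the threshold.\<close>
  define S where "S = (\<lambda>(k, p, q). A k (unit_fun p)) ` ({..<c} \<times> E)"
  have finS: "finite S" using finE by (simp add: S_def)
  have "card S \<le> c * card E"
    unfolding S_def using card_image_le[of "{..<c} \<times> E" "\<lambda>(k, p, q). A k (unit_fun p)"] finE
    by (simp add: card_cartesian_product)
  also have "\<dots> \<le> c * c" using cardE by (intro mult_le_mono) auto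
  finally have "rank_bound M (card K) (card S) \<le> R"
    unfolding R_def K(4) by (rule rank_bound_mono)
  then have "\<not> fun_space.low_rank (rank_bound M (card K) (card S)) (\<lambda>x. A k0 x + (\<Sum>k\<in>K. fun_scale (\<alpha> k) (A k x)))" for \<alpha>
    using high fun_space.low_rank_mono by blast
  from fun_space.exists_joint_notin_span[where A = A, OF _ K(1,2) finS this]
  obtain x where x: "\<forall>j<M. A k0 (x j) \<notin>
    fun_space.span (S \<union> (\<lambda>(k, i). A k (x i)) ` (insert k0 K \<times> {..<M} - {(k0, j)}))"
    by (auto simp only: A_def contract_add)
  have A_outside: "A k u j = 0" if "j \<notin> {..<n2}" for k u j using that by (simp add: A_def contract_def)
  define G where "G j = S \<union> (\<lambda>(k, i). A k (x i)) ` (insert k0 K \<times> {..<M} - {(k0, j)})" for j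
  define dual where "dual j y \<longleftrightarrow> (\<forall>v\<in>G j. (\<Sum>l<n2. y l * v l) = 0) \<and> (\<Sum>l<n2. y l * A k0 (x j) l) = 1"
    for j y
  have "\<exists>y. dual j y" if "j < M" for j
  proof (rule separating_vector[OF finite_lessThan[of n2] x[rule_format, OF that, folded G_def]])
    fix y assume "\<And>v. v \<in> G j \<Longrightarrow> (\<Sum>l<n2. y l * v l) = 0" "(\<Sum>l<n2. y l * A k0 (x j) l) = 1"
    then show ?thesis unfolding dual_def by blast
  qed (auto simp: S_def G_def A_outside)
  then have "\<forall>j\<in>{..<M}. \<exists>y. dual j y" by simp
  from bchoice[OF this] obtain y where y: "\<forall>j\<in>{..<M}. dual j (y j)" by blast
  have y0: "(\<Sum>l<n2. y j l * v l) = 0" if "j < M" "v \<in> G j" for j v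
    using y that by (auto simp: dual_def)
  have y1: "(\<Sum>l<n2. y j l * A k0 (x j) l) = 1" if "j < M" for j
    using y that by (auto simp: dual_def)
  have second: "tri_form n1 n2 c T (unit_fun p) (y j) (w k) = 0" if "(p, q) \<in> E" "j < M" "k < c" for p q j k
  proof -
    have "A k (unit_fun p) \<in> S" unfolding S_def using that by force
    then show ?thesis using y0[OF that(2), of "A k (unit_fun p)"] by (simp add: G_def tri_form_eq A_def)
  qed
  have third: "tri_form n1 n2 c T (x i) (y j) (w k) = (if k = k0 \<and> i = j then 1 else 0)"
    if "i < M" "j < M" "k < c" for i j k
  proof (cases "k = k0 \<and> i = j")
    case True
    then show ?thesis using y1[OF that(2)] by (simp add: tri_form_eq A_def)
  next
    case False
    then have "(k, i) \<in> insert k0 K \<times> {..<M} - {(k0, j)}" using that K(3) by auto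
    then have "A k (x i) \<in> G j" unfolding G_def by (intro UnI2 rev_image_eqI) auto
    then have "(\<Sum>l<n2. y j l * A k (x i) l) = 0" by (rule y0[OF that(2)])
    then show ?thesis using False by (simp add: tri_form_eq A_def)
  qed
  have "block_structure n1 n2 c T M k0 w E C x y"
    unfolding block_structure_def using k0(1) finE cardE first[unfolded K_def] second third by blast
  then show thesis by (rule that)
qed

section \<open>Kronecker powers\<close>

text \<open>Digit 0 is the least significant one and belongs to the last factor of
  \<open>kronecker_power\<close>, in accordance with the index \<open>u * d + v\<close>.\<close>

definition digit :: "nat \<Rightarrow> nat \<Rightarrow> nat \<Rightarrow> nat" where
  "digit n t i = i div n ^ t mod n"

lemma sum_div_mod:
  fixes f :: "nat \<Rightarrow> nat \<Rightarrow> 'b::comm_monoid_add"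
  shows "(\<Sum>i<m * n. f (i div n) (i mod n)) = (\<Sum>a<m. \<Sum>b<n. f a b)"
proof -
  have "(\<Sum>a<m. \<Sum>b<n. f a b) = (\<Sum>a<m. \<Sum>i\<in>{a * n..<a * n + n}. f (i div n) (i mod n))"
  proof (rule sum.cong[OF refl])
    fix a
    have "(\<Sum>i\<in>{0 + a * n..<n + a * n}. f (i div n) (i mod n)) = (\<Sum>b\<in>{0..<n}. f ((b + a * n) div n) ((b + a * n) mod n))"
      by (rule sum.shift_bounds_nat_ivl)
    also have "\<dots> = (\<Sum>b<n. f a b)" by (auto simp: atLeast0LessThan intro!: sum.cong)
    finally show "(\<Sum>b<n. f a b) = (\<Sum>i\<in>{a * n..<a * n + n}. f (i div n) (i mod n))"
      by (simp add: add.commute)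
  qed
  then show ?thesis unfolding sum.nat_group by (rule sym)
qed

lemma digit_0 [simp]: "digit n 0 i = i mod n"
  by (simp add: digit_def)

lemma digit_Suc: "digit n (Suc t) i = digit n t (i div n)"
  by (simp add: digit_def div_mult2_eq)

lemma sum_prod_digit:
  fixes f :: "nat \<Rightarrow> nat \<Rightarrow> 'b::comm_semiring_1"
  shows "(\<Sum>i<n ^ m. \<Prod>t<m. f t (digit n t i)) = (\<Prod>t<m. \<Sum>a<n. f t a)"
proof (induction m arbitrary: f)
  case (Suc m)
  have "(\<Sum>i<n ^ Suc m. \<Prod>t<Suc m. f t (digit n t i))
    = (\<Sum>i<n ^ m * n. f 0 (i mod n) * (\<Prod>t<m. f (Suc t) (digit n t (i div n))))"
    by (simp only: prod.lessThan_Suc_shift digit_0 digit_Suc power_Suc mult.commute)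
  also have "\<dots> = (\<Sum>i<n ^ m. \<Sum>a<n. f 0 a * (\<Prod>t<m. f (Suc t) (digit n t i)))"
    by (rule sum_div_mod)
  also have "\<dots> = (\<Sum>a<n. f 0 a) * (\<Sum>i<n ^ m. \<Prod>t<m. f (Suc t) (digit n t i))"
    by (simp add: sum_product sum.swap[of _ "{..<n}"])
  also have "\<dots> = (\<Prod>t<Suc m. \<Sum>a<n. f t a)"
    by (simp only: Suc.IH[of "\<lambda>t. f (Suc t)"] prod.lessThan_Suc_shift)
  finally show ?case .
qed simp

lemma kronecker_power_digits:
  "kronecker_power n1 n2 n3 T m i j k = (\<Prod>t<m. T (digit n1 t i) (digit n2 t j) (digit n3 t k))"
proof (induction m arbitrary: i j k)
  case (Suc m)
  show ?case
    unfolding prod.lessThan_Suc_shift by (simp add: kronecker_def Suc.IH digit_Suc mult.commute)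
qed simp

text \<open>Product vectors are evaluated position by position, which reduces the power to the block
  structure of a single factor.\<close>

lemma tri_form_power:
  "tri_form (n1 ^ m) (n2 ^ m) (n3 ^ m) (kronecker_power n1 n2 n3 T m)
     (\<lambda>i. \<Prod>t<m. u t (digit n1 t i)) (\<lambda>j. \<Prod>t<m. v t (digit n2 t j)) (\<lambda>k. \<Prod>t<m. w t (digit n3 t k))
   = (\<Prod>t<m. tri_form n1 n2 n3 T (u t) (v t) (w t))"
proof -
  have "(\<Sum>i<n1 ^ m. \<Sum>j<n2 ^ m. \<Sum>k<n3 ^ m. \<Prod>t<m. F t (digit n1 t i) (digit n2 t j) (digit n3 t k))
    = (\<Prod>t<m. \<Sum>i<n1. \<Sum>j<n2. \<Sum>k<n3. F t i j k)" for F :: "nat \<Rightarrow> nat \<Rightarrow> nat \<Rightarrow> nat \<Rightarrow> 'a"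
  proof -
    have "(\<Sum>k<n3 ^ m. \<Prod>t<m. F t (digit n1 t i) (digit n2 t j) (digit n3 t k))
      = (\<Prod>t<m. \<Sum>k<n3. F t (digit n1 t i) (digit n2 t j) k)" for i j
      by (rule sum_prod_digit)
    moreover have "(\<Sum>j<n2 ^ m. \<Prod>t<m. \<Sum>k<n3. F t (digit n1 t i) (digit n2 t j) k)
      = (\<Prod>t<m. \<Sum>j<n2. \<Sum>k<n3. F t (digit n1 t i) j k)" for i
      by (rule sum_prod_digit)
    moreover have "(\<Sum>i<n1 ^ m. \<Prod>t<m. \<Sum>j<n2. \<Sum>k<n3. F t (digit n1 t i) j k)
      = (\<Prod>t<m. \<Sum>i<n1. \<Sum>j<n2. \<Sum>k<n3. F t i j k)"
      by (rule sum_prod_digit)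
    ultimately show ?thesis by simp
  qed
  from this[of "\<lambda>t i j k. u t i * v t j * w t k * T i j k"] show ?thesis
    by (simp only: tri_form_def kronecker_power_digits prod.distrib)
qed

lemma tri_form_sum:
  "tri_form n1 n2 n3 T (\<lambda>i. \<Sum>a\<in>A. f a i) (\<lambda>j. \<Sum>b\<in>B. g b j) w
   = (\<Sum>a\<in>A. \<Sum>b\<in>B. tri_form n1 n2 n3 T (f a) (g b) w)"
proof -
  have "tri_form n1 n2 n3 T (\<lambda>i. \<Sum>a\<in>A. f a i) v w = (\<Sum>a\<in>A. tri_form n1 n2 n3 T (f a) v w)" for v
    unfolding tri_form_def by (simp add: sum_distrib_right sum.swap[of _ A])
  moreover have "tri_form n1 n2 n3 T u (\<lambda>j. \<Sum>b\<in>B. g b j) w = (\<Sum>b\<in>B. tri_form n1 n2 n3 T u (g b) w)" for u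
    unfolding tri_form_def by (simp add: sum_distrib_right sum_distrib_left sum.swap[of _ B])
  ultimately show ?thesis by simp
qed

lemma tri_form_scale2:
  "tri_form n1 n2 n3 T u (\<lambda>j. b * v j) w = b * tri_form n1 n2 n3 T u v w"
  by (simp add: tri_form_def sum_distrib_left algebra_simps)

section \<open>Unit tensors inside Kronecker powers\<close>

lemma restricts_to_unit_card:
  fixes X Y W :: "'z \<Rightarrow> nat \<Rightarrow> 'a::field"
  assumes "finite Z"
    and "\<And>a b d. a \<in> Z \<Longrightarrow> b \<in> Z \<Longrightarrow> d \<in> Z \<Longrightarrow>
      tri_form n1 n2 n3 T (X a) (Y b) (W d) = (if a = b \<and> b = d then 1 else 0)"
  shows "restricts_to_unit n1 n2 n3 T (card Z)"
proof -
  obtain h where h: "bij_betw h {..<card Z} Z"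
    using assms(1) by (metis atLeast0LessThan ex_bij_betw_nat_finite)
  define L where "L V n = mat (card Z) n (\<lambda>(a, i). V (h a) i)" for V :: "'z \<Rightarrow> nat \<Rightarrow> 'a" and n
  have "apply_maps n1 n2 n3 (L X n1) (L Y n2) (L W n3) T a b d = unit_tensor a b d"
    if "a < card Z" "b < card Z" "d < card Z" for a b d
  proof -
    have "h a \<in> Z" "h b \<in> Z" "h d \<in> Z" using h that by (auto simp: bij_betw_def)
    from assms(2)[OF this]
    have "tri_form n1 n2 n3 T (X (h a)) (Y (h b)) (W (h d)) = (if h a = h b \<and> h b = h d then 1 else 0)" .
    moreover have "h a = h b \<longleftrightarrow> a = b" "h b = h d \<longleftrightarrow> b = d"
      using h that by (auto simp: bij_betw_def inj_on_def)
    ultimately show ?thesis using that by (simp add: apply_maps_def tri_form_def L_def unit_tensor_def)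
  qed
  moreover have "L V n \<in> carrier_mat (card Z) n" for V n by (simp add: L_def)
  ultimately show ?thesis unfolding restricts_to_unit_def by blast
qed

text \<open>A summand is indexed by a set of old positions and a word over \<open>K\<close> on it.
  Words over \<open>E\<close> cannot belong to the index, since \<open>C\<close> gives a Kronecker
  delta only after summation over \<open>E\<close>. So the vectors on the first two legs are sums
  over such words, and \<open>room\<close> lets the new block record both words, which keeps the two
  sums synchronised.\<close>

lemma restricts_to_unit_power:
  fixes T :: "'a::field tensor3"
  assumes block: "block_structure n1 n2 c T M k0 w E C x y"
    and a: "a \<le> m" and room: "((c - 1) * card E) ^ a \<le> M ^ (m - a)"
  shows "restricts_to_unit (n1 ^ m) (n2 ^ m) (c ^ m) (kronecker_power n1 n2 c T m) ((m choose a) * (c - 1) ^ a)"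
proof -
  define K where K: "K = {..<c} - {k0}"
  have k0: "k0 < c" and E: "finite E" using block by (auto simp: block_structure_def)
  have block1: "(\<Sum>(p, q)\<in>E. C k (p, q) * tri_form n1 n2 c T (unit_fun p) (unit_fun q) (w k')) =
      (if k = k' then 1 else 0)" if "k \<in> K" "k' \<in> K" for k k'
    using block that unfolding block_structure_def K by blast
  have off: "tri_form n1 n2 c T (unit_fun p) (y j) (w k) = 0" if "(p, q) \<in> E" "j < M" "k < c" for p q j k
    using block that unfolding block_structure_def by fast
  have block2: "tri_form n1 n2 c T (x i) (y j) (w k) = (if k = k0 \<and> i = j then 1 else 0)"
    if "i < M" "j < M" "k < c" for i j k
    using block that unfolding block_structure_def by blast
  define Ps where "Ps = {P. P \<subseteq> {..<m} \<and> card P = a}"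
  define Z where "Z = (SIGMA P:Ps. PiE P (\<lambda>_. K))"
  have finK: "finite K" "card K = c - 1" using k0 by (auto simp: K)
  have finP: "finite P" if "P \<in> Ps" for P using that finite_subset by (auto simp: Ps_def)
  have finPs: "finite Ps" unfolding Ps_def by (rule finite_subset[of _ "Pow {..<m}"]) auto
  have finZ: "finite Z" unfolding Z_def using finPs finP finK(1) by (intro finite_SigmaI finite_PiE) auto
  have cardZ: "card Z = (m choose a) * (c - 1) ^ a"
  proof -
    have "card Z = (\<Sum>P\<in>Ps. card (PiE P (\<lambda>_. K)))"
      unfolding Z_def using finPs finP finK(1) by (intro card_SigmaI) (auto intro!: finite_PiE)
    also have "\<dots> = (\<Sum>P\<in>Ps. (c - 1) ^ a)"
      using finP finK(2) by (intro sum.cong) (auto simp: card_PiE Ps_def)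
    also have "\<dots> = (m choose a) * (c - 1) ^ a"
      unfolding Ps_def using n_subsets[of "{..<m}" a] by simp
    finally show ?thesis .
  qed
  \<comment> \<open>Words on the old block are recorded injectively by words on the new block, so that a term of
    the product form with two different records vanishes.\<close>
  define code where "code P \<iota> \<longleftrightarrow> inj_on \<iota> (PiE P (\<lambda>_. K) \<times> PiE P (\<lambda>_. E)) \<and>
    \<iota> ` (PiE P (\<lambda>_. K) \<times> PiE P (\<lambda>_. E)) \<subseteq> PiE ({..<m} - P) (\<lambda>_. {..<M})" for P and \<iota> :: "(nat \<Rightarrow> nat) \<times> (nat \<Rightarrow> nat \<times> nat) \<Rightarrow> nat \<Rightarrow> nat"
  have "\<exists>\<iota>. code P \<iota>" if P: "P \<in> Ps" for P
  proof -
    have "card (PiE P (\<lambda>_. K) \<times> PiE P (\<lambda>_. E)) = ((c - 1) * card E) ^ a"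
      using P finP[OF P] finK(2) by (auto simp: card_cartesian_product card_PiE Ps_def power_mult_distrib)
    moreover have "card (PiE ({..<m} - P) (\<lambda>_. {..<M})) = M ^ (m - a)"
      using P finP[OF P] by (simp add: card_PiE Ps_def card_Diff_subset)
    ultimately have "card (PiE P (\<lambda>_. K) \<times> PiE P (\<lambda>_. E)) \<le> card (PiE ({..<m} - P) (\<lambda>_. {..<M}))"
      using room by simp
    then show ?thesis unfolding code_def
      using finP[OF P] finK(1) E by (subst inj_on_iff_card_le) (auto intro!: finite_PiE)
  qed
  then have "\<forall>P\<in>Ps. \<exists>\<iota>. code P \<iota>" by blast
  from bchoice[OF this] obtain \<iota> where \<iota>: "\<forall>P\<in>Ps. code P (\<iota> P)" by blast
  have \<iota>_mem: "\<iota> P (\<kappa>, \<epsilon>) \<in> PiE ({..<m} - P) (\<lambda>_. {..<M})"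
    if "P \<in> Ps" "\<kappa> \<in> PiE P (\<lambda>_. K)" "\<epsilon> \<in> PiE P (\<lambda>_. E)" for P \<kappa> \<epsilon>
  proof -
    have "(\<kappa>, \<epsilon>) \<in> PiE P (\<lambda>_. K) \<times> PiE P (\<lambda>_. E)" using that(2,3) by (rule SigmaI)
    then show ?thesis using \<iota>[rule_format, OF that(1)] unfolding code_def by (meson imageI subsetD)
  qed
  have \<iota>_less: "\<iota> P (\<kappa>, \<epsilon>) t < M"
    if "P \<in> Ps" "\<kappa> \<in> PiE P (\<lambda>_. K)" "\<epsilon> \<in> PiE P (\<lambda>_. E)" "t < m" "t \<notin> P" for P \<kappa> \<epsilon> t
    using PiE_mem[OF \<iota>_mem[OF that(1-3)], of t] that(4,5) by simp
  define u where "u = (\<lambda>(P, \<kappa>) \<epsilon> t. if t \<in> P then unit_fun (fst (\<epsilon> t)) else x (\<iota> P (\<kappa>, \<epsilon>) t))"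
  define v where "v = (\<lambda>(P, \<kappa>) \<epsilon> t. if t \<in> P then unit_fun (snd (\<epsilon> t)) else y (\<iota> P (\<kappa>, \<epsilon>) t))"
  define \<beta> where "\<beta> = (\<lambda>(P :: nat set, \<kappa>) \<epsilon>. \<Prod>t\<in>P. C (\<kappa> t) (\<epsilon> t))"
  define letter where "letter = (\<lambda>(P, \<kappa>) (t :: nat). if t \<in> P then \<kappa> t else k0)"
  \<comment> \<open>The weights \<open>\<beta>\<close> sit on the second leg only, so that each
    surviving term carries them exactly once.\<close>
  define X where "X = (\<lambda>z i. \<Sum>\<epsilon>\<in>PiE (fst z) (\<lambda>_. E). \<Prod>t<m. u z \<epsilon> t (digit n1 t i))"
  define Y where "Y = (\<lambda>z j. \<Sum>\<epsilon>\<in>PiE (fst z) (\<lambda>_. E). \<beta> z \<epsilon> * (\<Prod>t<m. v z \<epsilon> t (digit n2 t j)))"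
  define W where "W = (\<lambda>z k. \<Prod>t<m. w (letter z t) (digit c t k))"
  define F where "F z \<epsilon> z' \<epsilon>' z'' t = tri_form n1 n2 c T (u z \<epsilon> t) (v z' \<epsilon>' t) (w (letter z'' t))"
    for z \<epsilon> z' \<epsilon>' z'' t
  have form: "tri_form (n1 ^ m) (n2 ^ m) (c ^ m) (kronecker_power n1 n2 c T m) (X z) (Y z') (W z'')
    = (\<Sum>\<epsilon>\<in>PiE (fst z) (\<lambda>_. E). \<Sum>\<epsilon>'\<in>PiE (fst z') (\<lambda>_. E). \<beta> z' \<epsilon>' * (\<Prod>t<m. F z \<epsilon> z' \<epsilon>' z'' t))" for z z' z''
    unfolding X_def Y_def W_def F_def
    by (simp only: tri_form_sum tri_form_scale2 tri_form_power[where w = "\<lambda>t. w (letter z'' t)"])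
  have letter_less: "letter z t < c" if zZ: "z \<in> Z" for z t
  proof -
    obtain P \<kappa> where z: "z = (P, \<kappa>)" "\<kappa> \<in> PiE P (\<lambda>_. K)" using zZ by (auto simp: Z_def)
    have "\<kappa> t \<in> K" if "t \<in> P" using PiE_mem[OF z(2) that] .
    then show ?thesis using k0 by (auto simp: z(1) letter_def K)
  qed
  \<comment> \<open>A new vector on the first leg against an old one on the second is unconstrained,
    so the zero factors yield only inclusions of position sets; the common size \<open>a\<close>
    turns them into equalities. The word over \<open>K\<close> in \<open>z''\<close> stays free here
    and is compared later by duality.\<close>
  have vanish: "fst z'' = fst z \<and> z = z' \<and> \<epsilon> = \<epsilon>'"
    if Zs: "z \<in> Z" "z' \<in> Z" "z'' \<in> Z" and \<epsilon>: "\<epsilon> \<in> PiE (fst z) (\<lambda>_. E)" and \<epsilon>': "\<epsilon>' \<in> PiE (fst z') (\<lambda>_. E)"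
      and nz: "\<And>t. t < m \<Longrightarrow> F z \<epsilon> z' \<epsilon>' z'' t \<noteq> 0" for z z' z'' \<epsilon> \<epsilon>'
  proof -
    obtain P \<kappa> P' \<kappa>' P'' \<kappa>'' where z: "z = (P, \<kappa>)" "z' = (P', \<kappa>')" "z'' = (P'', \<kappa>'')"
      by (metis surj_pair)
    have Ps: "P \<in> Ps" "P' \<in> Ps" "P'' \<in> Ps" and \<kappa>: "\<kappa> \<in> PiE P (\<lambda>_. K)" "\<kappa>' \<in> PiE P' (\<lambda>_. K)" "\<kappa>'' \<in> PiE P'' (\<lambda>_. K)"
      using Zs by (auto simp: Z_def z)
    have card: "card P = a" "card P' = a" "card P'' = a" using Ps by (simp_all add: Ps_def)
    have \<epsilon>s: "\<epsilon> \<in> PiE P (\<lambda>_. E)" "\<epsilon>' \<in> PiE P' (\<lambda>_. E)" using \<epsilon> \<epsilon>' by (simp_all add: z)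
    have "P \<subseteq> P'"
    proof
      fix t assume t: "t \<in> P"
      then have "t < m" using Ps(1) by (auto simp: Ps_def)
      show "t \<in> P'"
      proof (rule ccontr)
        assume "t \<notin> P'"
        have e: "(fst (\<epsilon> t), snd (\<epsilon> t)) \<in> E" using \<epsilon> t by (auto simp: z)
        then have "F z \<epsilon> z' \<epsilon>' z'' t = 0"
          using off[OF e \<iota>_less[OF Ps(2) \<kappa>(2) \<epsilon>s(2) \<open>t < m\<close> \<open>t \<notin> P'\<close>] letter_less[OF Zs(3)], of t] t \<open>t \<notin> P'\<close>
          by (simp add: F_def u_def v_def z)
        then show False using nz[OF \<open>t < m\<close>] by blast
      qed
    qed
    from card_subset_eq[OF finP[OF Ps(2)] this] card have P': "P' = P" by simp
    have out: "letter z'' t = k0 \<and> \<iota> P (\<kappa>, \<epsilon>) t = \<iota> P (\<kappa>', \<epsilon>') t" if t: "t < m" "t \<notin> P" for t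
    proof -
      have "F z \<epsilon> z' \<epsilon>' z'' t = tri_form n1 n2 c T (x (\<iota> P (\<kappa>, \<epsilon>) t)) (y (\<iota> P (\<kappa>', \<epsilon>') t)) (w (letter z'' t))"
        using t by (simp add: F_def u_def v_def z P')
      also have "\<dots> = (if letter z'' t = k0 \<and> \<iota> P (\<kappa>, \<epsilon>) t = \<iota> P (\<kappa>', \<epsilon>') t then 1 else 0)"
        using \<kappa> \<epsilon>s t by (intro block2 letter_less Zs \<iota>_less Ps(1)) (simp_all add: P')
      finally show ?thesis using nz[OF t(1)] by presburger
    qed
    have "P'' \<subseteq> P"
    proof
      fix t assume t: "t \<in> P''"
      then have "t < m" "letter z'' t \<noteq> k0" using Ps(3) \<kappa>(3) by (auto simp: Ps_def letter_def z K)
      then show "t \<in> P" using out by blast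
    qed
    from card_subset_eq[OF finP[OF Ps(1)] this] card have P'': "P'' = P" by simp
    have code: "code P (\<iota> P)" using \<iota> Ps(1) by blast
    have mem: "(\<kappa>, \<epsilon>) \<in> PiE P (\<lambda>_. K) \<times> PiE P (\<lambda>_. E)" "(\<kappa>', \<epsilon>') \<in> PiE P (\<lambda>_. K) \<times> PiE P (\<lambda>_. E)"
      using \<kappa> \<epsilon>s by (simp_all add: P')
    have "\<iota> P (\<kappa>, \<epsilon>) = \<iota> P (\<kappa>', \<epsilon>')"
    proof (rule PiE_ext)
      show "\<iota> P (\<kappa>, \<epsilon>) \<in> PiE ({..<m} - P) (\<lambda>_. {..<M})" "\<iota> P (\<kappa>', \<epsilon>') \<in> PiE ({..<m} - P) (\<lambda>_. {..<M})"
        using \<iota>_mem[OF Ps(1)] \<kappa> \<epsilon>s unfolding P' by blast+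
    qed (use out in auto)
    then have "(\<kappa>, \<epsilon>) = (\<kappa>', \<epsilon>')" using code mem unfolding code_def by (meson inj_onD)
    then show ?thesis by (simp add: z P' P'')
  qed
  have "tri_form (n1 ^ m) (n2 ^ m) (c ^ m) (kronecker_power n1 n2 c T m) (X z) (Y z') (W z'')
      = (if z = z' \<and> z' = z'' then 1 else 0)" if Zs: "z \<in> Z" "z' \<in> Z" "z'' \<in> Z" for z z' z''
  proof (cases "z = z' \<and> fst z'' = fst z")
    case False
    have "(\<Prod>t<m. F z \<epsilon> z' \<epsilon>' z'' t) = 0" if "\<epsilon> \<in> PiE (fst z) (\<lambda>_. E)" "\<epsilon>' \<in> PiE (fst z') (\<lambda>_. E)" for \<epsilon> \<epsilon>'
    proof (rule ccontr)
      assume "\<not> ?thesis"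
      then have "\<And>t. t < m \<Longrightarrow> F z \<epsilon> z' \<epsilon>' z'' t \<noteq> 0" by (auto simp: prod_zero_iff)
      from vanish[OF Zs that this] False show False by blast
    qed
    then have "tri_form (n1 ^ m) (n2 ^ m) (c ^ m) (kronecker_power n1 n2 c T m) (X z) (Y z') (W z'') = 0"
      unfolding form by (intro sum.neutral ballI) simp
    then show ?thesis using False by auto
  next
    case True
    obtain P \<kappa> \<kappa>'' where z: "z = (P, \<kappa>)" "z' = (P, \<kappa>)" "z'' = (P, \<kappa>'')"
      using True by (metis fst_conv surj_pair)
    have P: "P \<in> Ps" "P \<subseteq> {..<m}" and \<kappa>: "\<kappa> \<in> PiE P (\<lambda>_. K)" "\<kappa>'' \<in> PiE P (\<lambda>_. K)"
      using Zs by (auto simp: Z_def z Ps_def)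
    have finE: "finite (PiE P (\<lambda>_. E))" using finP[OF P(1)] E by (simp add: finite_PiE)
    have diag: "(\<Sum>\<epsilon>'\<in>PiE P (\<lambda>_. E). \<beta> z \<epsilon>' * (\<Prod>t<m. F z \<epsilon> z \<epsilon>' z'' t)) = \<beta> z \<epsilon> * (\<Prod>t<m. F z \<epsilon> z \<epsilon> z'' t)"
      if \<epsilon>: "\<epsilon> \<in> PiE P (\<lambda>_. E)" for \<epsilon>
    proof -
      have "(\<Prod>t<m. F z \<epsilon> z \<epsilon>' z'' t) = 0" if "\<epsilon>' \<in> PiE P (\<lambda>_. E)" "\<epsilon>' \<noteq> \<epsilon>" for \<epsilon>'
      proof (rule ccontr)
        assume "\<not> ?thesis"
        then have "\<And>t. t < m \<Longrightarrow> F z \<epsilon> z \<epsilon>' z'' t \<noteq> 0" by (auto simp: prod_zero_iff)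
        from vanish[OF Zs(1) Zs(1) Zs(3) _ _ this] \<epsilon> that show False by (auto simp: z)
      qed
      then have "(\<Sum>\<epsilon>'\<in>PiE P (\<lambda>_. E) - {\<epsilon>}. \<beta> z \<epsilon>' * (\<Prod>t<m. F z \<epsilon> z \<epsilon>' z'' t)) = 0"
        by (intro sum.neutral) auto
      then show ?thesis by (subst sum.remove[OF finE \<epsilon>]) simp
    qed
    have summand: "\<beta> z \<epsilon> * (\<Prod>t<m. F z \<epsilon> z \<epsilon> z'' t) = (\<Prod>t\<in>P. (\<lambda>(p, q). C (\<kappa> t) (p, q) *
        tri_form n1 n2 c T (unit_fun p) (unit_fun q) (w (\<kappa>'' t))) (\<epsilon> t))" if \<epsilon>: "\<epsilon> \<in> PiE P (\<lambda>_. E)" for \<epsilon>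
    proof -
      have "F z \<epsilon> z \<epsilon> z'' t = 1" if t: "t < m" "t \<notin> P" for t
      proof -
        have "\<iota> P (\<kappa>, \<epsilon>) t < M" by (rule \<iota>_less[OF P(1) \<kappa>(1) \<epsilon> t])
        then show ?thesis using block2[of _ _ k0] k0 t by (simp add: F_def u_def v_def z letter_def)
      qed
      then have "(\<Prod>t<m. F z \<epsilon> z \<epsilon> z'' t) = (\<Prod>t\<in>P. F z \<epsilon> z \<epsilon> z'' t)"
        using P(2) by (intro prod.mono_neutral_right) auto
      moreover have "F z \<epsilon> z \<epsilon> z'' t = tri_form n1 n2 c T (unit_fun (fst (\<epsilon> t))) (unit_fun (snd (\<epsilon> t))) (w (\<kappa>'' t))"
        if "t \<in> P" for t
        using that by (simp add: F_def u_def v_def z letter_def)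
      ultimately show ?thesis by (simp add: \<beta>_def z prod.distrib split_def)
    qed
    have "tri_form (n1 ^ m) (n2 ^ m) (c ^ m) (kronecker_power n1 n2 c T m) (X z) (Y z') (W z'')
      = (\<Sum>\<epsilon>\<in>PiE P (\<lambda>_. E). \<Prod>t\<in>P. (\<lambda>(p, q). C (\<kappa> t) (p, q) *
        tri_form n1 n2 c T (unit_fun p) (unit_fun q) (w (\<kappa>'' t))) (\<epsilon> t))"
      unfolding form using diag summand by (simp add: z)
    \<comment> \<open>Distributivity turns the sum over words into a product over positions, and
      each factor is the duality relation between \<open>C\<close> and the slices in
      \<open>K\<close>.\<close>
    also have "\<dots> = (\<Prod>t\<in>P. \<Sum>(p, q)\<in>E. C (\<kappa> t) (p, q) * tri_form n1 n2 c T (unit_fun p) (unit_fun q) (w (\<kappa>'' t)))"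
      using finP[OF P(1)] E by (subst prod_sum_PiE) auto
    also have "\<dots> = (\<Prod>t\<in>P. if \<kappa> t = \<kappa>'' t then 1 else 0)"
      using \<kappa> by (intro prod.cong refl block1) auto
    also have "\<dots> = (if \<kappa> = \<kappa>'' then 1 else 0)"
    proof (cases "\<kappa> = \<kappa>''")
      case False
      then obtain t where "t \<in> P" "\<kappa> t \<noteq> \<kappa>'' t" using \<kappa> PiE_ext by blast
      then show ?thesis using False finP[OF P(1)] by (auto intro!: prod_zero)
    qed simp
    finally show ?thesis by (simp add: z)
  qed
  from restricts_to_unit_card[OF finZ this] show ?thesis by (simp add: cardZ)
qed

section \<open>Asymptotics\<close>

text \<open>The expansion of \<open>(c - 1 + 1) ^ m\<close> has \<open>m + 1\<close> terms, so the
  largest is at least their mean. Comparing it with the preceding term bounds \<open>a\<close> away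
  from \<open>m\<close>, which guarantees enough positions on the new block.\<close>

lemma exists_large_binomial_term:
  assumes "c \<ge> (2::nat)"
  obtains a where "a \<le> m" "c ^ m \<le> (m + 1) * ((m choose a) * (c - 1) ^ a)" "a * c \<le> (m + 1) * (c - 1)"
proof -
  define f where "f a = (m choose a) * (c - 1) ^ a" for a
  have "Max (f ` {..m}) \<in> f ` {..m}" by (rule Max_in) auto
  then obtain a where a: "a \<le> m" "f a = Max (f ` {..m})" by (elim imageE) simp
  have max: "f b \<le> f a" if "b \<le> m" for b using that by (auto simp: a(2))
  have "c ^ m = (c - 1 + 1) ^ m" using assms by simp
  also have "\<dots> = (\<Sum>b\<le>m. f b)" unfolding binomial_ring by (simp add: f_def)
  also have "\<dots> \<le> (m + 1) * f a" using sum_bounded_above[of "{..m}" f "f a"] max by simp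
  finally have sum: "c ^ m \<le> (m + 1) * f a" .
  have "a * c \<le> (m + 1) * (c - 1)"
  proof (cases a)
    case (Suc b)
    have "b \<le> m" using a(1) Suc by simp
    have "(m choose b) * (c - 1) ^ b \<le> ((m choose a) * (c - 1)) * (c - 1) ^ b"
      using max[OF \<open>b \<le> m\<close>] by (simp add: f_def Suc mult_ac)
    then have "(m choose b) \<le> (m choose a) * (c - 1)" using assms by simp
    then have "a * (m choose b) \<le> a * (m choose a) * (c - 1)"
      by (metis mult.assoc mult_le_mono2)
    also have "a * (m choose a) = (m - b) * (m choose b)"
      using binomial_absorption[of b m] binomial_absorb_comp[of m b] by (simp add: Suc)
    finally have "(m choose b) * a \<le> (m choose b) * ((m - b) * (c - 1))" by (simp add: mult_ac)
    moreover have "(m choose b) > 0" using \<open>b \<le> m\<close> by simp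
    ultimately have "a \<le> (m - b) * (c - 1)" by simp
    then have "a * (c - 1) + a \<le> (a + (m - b)) * (c - 1)" by (simp add: add_mult_distrib)
    moreover have "a + (m - b) = m + 1" using \<open>b \<le> m\<close> Suc by simp
    moreover have "a * (c - 1) + a = a * c" using assms by (simp add: algebra_simps)
    ultimately show ?thesis by simp
  qed simp
  with a(1) sum show thesis using that unfolding f_def by blast
qed

text \<open>With more than \<open>n3\<close> rows, \<open>L3\<close> has a nontrivial relation
  \<open>y\<close> between its rows. Contracting the third leg with \<open>y\<close> then gives
  zero, but for the unit tensor the diagonal entry at \<open>b\<close> is
  \<open>y b\<close>.\<close>

lemma restricts_to_unit_le:
  assumes "restricts_to_unit n1 n2 n3 T r"
  shows "r \<le> n3"
proof (rule ccontr)
  assume "\<not> r \<le> n3"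
  obtain L1 L2 L3 where L: "\<And>a b d. a < r \<Longrightarrow> b < r \<Longrightarrow> d < r \<Longrightarrow> apply_maps n1 n2 n3 L1 L2 L3 T a b d = unit_tensor a b d"
    using assms unfolding restricts_to_unit_def by blast
  define S where "S = (\<lambda>k d. L3 $$ (d, k)) ` {..<n3}"
  have "card S < card {..<r}"
    using card_image_le[of "{..<n3}" "\<lambda>k d. L3 $$ (d, k)"] \<open>\<not> r \<le> n3\<close> by (simp add: S_def)
  then obtain y where y: "\<exists>d\<in>{..<r}. y d \<noteq> 0" "\<And>v. v \<in> fun_space.span S \<Longrightarrow> (\<Sum>d<r. y d * v d) = 0"
    using exists_annihilator[of "{..<r}" S] by (auto simp: S_def)
  have y0: "(\<Sum>d<r. y d * L3 $$ (d, k)) = 0" if "k < n3" for k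
    using that by (intro y(2)[of "\<lambda>d. L3 $$ (d, k)"] fun_space.span_base) (auto simp: S_def)
  obtain b where b: "b < r" "y b \<noteq> 0" using y(1) by auto
  have "y b = (\<Sum>d<r. y d * unit_tensor b b d)"
    using b(1) by (simp add: unit_tensor_def if_distrib cong: if_cong)
  also have "\<dots> = (\<Sum>d<r. y d * apply_maps n1 n2 n3 L1 L2 L3 T b b d)"
    using L b(1) by simp
  also have "\<dots> = (\<Sum>d<r. \<Sum>i<n1. \<Sum>j<n2. \<Sum>k<n3. (L1 $$ (b, i) * L2 $$ (b, j) * T i j k) * (y d * L3 $$ (d, k)))"
    by (simp add: apply_maps_def sum_distrib_left mult_ac)
  also have "\<dots> = (\<Sum>i<n1. \<Sum>j<n2. \<Sum>k<n3. (L1 $$ (b, i) * L2 $$ (b, j) * T i j k) * (\<Sum>d<r. y d * L3 $$ (d, k)))"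
    by (simp only: sum_distrib_left sum.swap[of _ _ "{..<r}"])
  also have "\<dots> = 0" using y0 by simp
  finally show False using b(2) by simp
qed

lemma finite_restricts_to_unit: "finite {r. restricts_to_unit n1 n2 n3 T r}"
  by (rule finite_subset[of _ "{..n3}"]) (auto dest: restricts_to_unit_le)

lemma le_subrank: "restricts_to_unit n1 n2 n3 T r \<Longrightarrow> r \<le> subrank n1 n2 n3 T"
  unfolding subrank_def by (rule Max_ge[OF finite_restricts_to_unit]) simp

lemma subrank_le: "subrank n1 n2 n3 T \<le> n3"
proof -
  have "restricts_to_unit n1 n2 n3 T 0"
    unfolding restricts_to_unit_def by (auto intro!: bexI[of _ "0\<^sub>m 0 _"])
  then have "subrank n1 n2 n3 T \<in> {r. restricts_to_unit n1 n2 n3 T r}"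
    unfolding subrank_def by (intro Max_in finite_restricts_to_unit) auto
  then show ?thesis by (auto dest: restricts_to_unit_le)
qed

lemma subrank_kronecker_power_ge:
  fixes T :: "'a::field tensor3"
  assumes T: "concise n1 n2 c T" and c: "c \<ge> 2"
    and large: "c * rank_bound ((c * c) ^ (2 * c)) (c - 1) (c * c) < n2" and m: "m \<ge> 2 * c"
  shows "c ^ m \<le> (m + 1) * subrank (n1 ^ m) (n2 ^ m) (c ^ m) (kronecker_power n1 n2 c T m)"
proof -
  \<comment> \<open>There are at most \<open>c * c\<close> choices per old position, and
    \<open>m \<le> 2 * c * (m - a)\<close> below, so it suffices that one new position can hold
    \<open>2 * c\<close> such choices.\<close>
  define M where "M = (c * c) ^ (2 * c)"
  obtain k0 w E C x y where block: "block_structure n1 n2 c T M k0 w E C x y"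
    by (rule concise_block_structure[OF T large[folded M_def]])
  then have cardE: "card E \<le> c - 1" by (simp add: block_structure_def)
  obtain a where a: "a \<le> m" "c ^ m \<le> (m + 1) * ((m choose a) * (c - 1) ^ a)" "a * c \<le> (m + 1) * (c - 1)"
    by (rule exists_large_binomial_term[OF c])
  have "(m - a) * c + (m + 1) * (c - 1) \<ge> m * c"
    using a(1,3) by (simp add: diff_mult_distrib)
  moreover have "(m + 1) * (c - 1) + m + 1 = m * c + c" using c by (cases c) (simp_all add: algebra_simps)
  ultimately have "m + 1 \<le> (m - a) * c + c" by linarith
  \<comment> \<open>Double the preceding inequality and absorb the resulting \<open>2 * c\<close>
    into \<open>m\<close>.\<close>
  then have exponent: "m \<le> 2 * c * (m - a)" using m by (simp add: algebra_simps)
  have "((c - 1) * card E) ^ a \<le> (c * c) ^ a"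
    using cardE by (intro power_mono mult_le_mono) auto
  also have "\<dots> \<le> (c * c) ^ (2 * c * (m - a))"
    using a(1) exponent c by (intro power_increasing) auto
  also have "\<dots> = M ^ (m - a)" by (simp add: M_def power_mult)
  finally have "((c - 1) * card E) ^ a \<le> M ^ (m - a)" .
  from restricts_to_unit_power[OF block a(1) this]
  have "(m choose a) * (c - 1) ^ a \<le> subrank (n1 ^ m) (n2 ^ m) (c ^ m) (kronecker_power n1 n2 c T m)"
    by (rule le_subrank)
  with a(2) show ?thesis by (meson le_trans mult_le_mono2)
qed

text \<open>The loss \<open>m + 1\<close> is at most \<open>2 * m\<close> for positive
  \<open>m\<close>, and the \<open>m\<close>-th roots of 2 and of \<open>m\<close> both tend to
  1.\<close>

lemma root_subexponential_tendsto:
  fixes f :: "nat \<Rightarrow> nat"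
  assumes lower: "\<And>m. m \<ge> m0 \<Longrightarrow> c ^ m \<le> (m + 1) * f m" and upper: "\<And>m. f m \<le> c ^ m"
  shows "(\<lambda>m. root m (real (f m))) \<longlonglongrightarrow> real c"
proof (rule real_tendsto_sandwich)
  have "(\<lambda>m. real c / (root m 2 * root m (real m))) \<longlonglongrightarrow> real c / (1 * 1)"
    by (intro tendsto_intros LIMSEQ_root LIMSEQ_root_const) auto
  then show "(\<lambda>m. real c / (root m 2 * root m (real m))) \<longlonglongrightarrow> real c" by simp
  show "eventually (\<lambda>m. real c / (root m 2 * root m (real m)) \<le> root m (real (f m))) sequentially"
    using eventually_ge_at_top[of "max 1 m0"]
  proof eventually_elim
    case (elim m)
    then have m: "m > 0" "m \<ge> m0" by auto
    have "real c ^ m \<le> (real m + 1) * real (f m)"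
      using lower[OF m(2)] by (metis of_nat_1 of_nat_add of_nat_le_iff of_nat_mult of_nat_power)
    also have "\<dots> \<le> (2 * real m) * real (f m)" using m by (intro mult_right_mono) auto
    finally have "root m (real c ^ m) \<le> root m (2 * real m * real (f m))" using m by simp
    then have "real c \<le> root m 2 * root m (real m) * root m (real (f m))"
      using m by (simp add: real_root_mult real_root_pos2 real_root_power_cancel)
    moreover have "root m 2 * root m (real m) > 0" using m by simp
    ultimately show ?case by (simp add: divide_le_eq mult.commute)
  qed
  show "eventually (\<lambda>m. root m (real (f m)) \<le> real c) sequentially"
    using eventually_gt_at_top[of 0]
  proof eventually_elim
    case (elim m)
    have "root m (real (f m)) \<le> root m (real c ^ m)"
      using elim upper[of m] by (simp flip: of_nat_power)
    then show ?case using elim by (simp add: real_root_power_cancel)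
  qed
qed simp

theorem theorem3p17:
  fixes c :: nat
  assumes "c \<ge> 2"
  shows "\<exists>N::nat. \<forall>n1 n2. max n1 n2 > N \<longrightarrow>
    (\<forall>T :: 'a::field tensor3. concise n1 n2 c T \<longrightarrow>
      (\<lambda>m. root m (real (subrank (n1 ^ m) (n2 ^ m) (c ^ m) (kronecker_power n1 n2 c T m))))
        \<longlonglongrightarrow> real c)"
proof (intro exI[of _ "c * (c * rank_bound ((c * c) ^ (2 * c)) (c - 1) (c * c))"] allI impI)
  fix n1 n2 and T :: "'a tensor3"
  let ?B = "c * rank_bound ((c * c) ^ (2 * c)) (c - 1) (c * c)"
  assume max: "c * ?B < max n1 n2" and T: "concise n1 n2 c T"
  \<comment> \<open>Otherwise \<open>n1 \<le> n2 * c\<close> would bound both dimensions by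
    \<open>c * ?B\<close>; this accounts for the outer factor \<open>c\<close> in the
    threshold.\<close>
  have "?B < n2"
  proof (rule ccontr)
    assume "\<not> ?B < n2"
    then have "n2 * c \<le> c * ?B" by simp
    moreover have "n2 \<le> n2 * c" using assms by simp
    ultimately show False using max concise_dim1_le[OF T] by linarith
  qed
  then show "(\<lambda>m. root m (real (subrank (n1 ^ m) (n2 ^ m) (c ^ m) (kronecker_power n1 n2 c T m))))
      \<longlonglongrightarrow> real c"
    using subrank_kronecker_power_ge[OF T assms] subrank_le
    by (intro root_subexponential_tendsto[of "2 * c"]) auto
qed

end
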